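(* Let $n\ge 1$. The action of the isometry group $I(\mathbb{R}^2_1)$ on the vector space $\mathcal{K}^n(\mathbb{R}^2_1)$ of Killing tensors of valence $n$ on the Minkowski plane has, in the coordinates $(c_{i,j})_{i,j\ge 0,\ i+j\le n}$ of the parameter space $\Sigma$, the following infinitesimal generators, corresponding respectively to the Killing vectors $\mathbf{T}=\partial_t$, $\mathbf{X}=\partial_x$, $\mathbf{H}=x\partial_t+t\partial_x$ via $\mathbf{V}_1=\pi\mathcal{L}_{\mathbf{T}}\mathbf{K}$, $\mathbf{V}_2=\pi\mathcal{L}_{\mathbf{X}}\mathbf{K}$, $\mathbf{V}_3=\pi\mathcal{L}_{\mathbf{H}}\mathbf{K}$: $$\mathbf{V}_1=\sum_{\substack{i\ge 0,\ j\ge 1\\ i+j\le n}} j\,c_{i,j-1}\,\frac{\partial}{\partial c_{i,j}},\qquad \mathbf{V}_2=\sum_{\substack{i\ge 1,\ j\ge 0\\ i+j\le n}} i\,c_{i-1,j}\,\frac{\partial}{\partial c_{i,j}},$$ $$\mathbf{V}_3=-\sum_{\substack{i,j\ge 0\\ i+j\le n}}\bigl(i\,c_{i-1,j+1}+j\,c_{i+1,j-1}\bigr)\frac{\partial}{\partial c_{i,j}},$$ where terms with coefficient $i=0$ or $j=0$ are read as zero.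
   Context: The Minkowski plane $\mathbb{R}^2_1$ is $\mathbb{R}^2$ with pseudo-Cartesian coordinates $(t,x)=(y^1,y^2)$ and flat metric $\mathbf{g}=\mathrm{diag}(1,-1)$. $I(\mathbb{R}^2_1)$ is the Lie group of maps $\tilde t=t\cosh\phi+x\sinh\phi+a$, $\tilde x=t\sinh\phi+x\cosh\phi+b$, with $\phi,a,b\in\mathbb{R}$. A Killing tensor of valence $n$ is a symmetric $(n,0)$-tensor (contravariant) field $\mathbf{K}$ with $[\mathbf{K},\mathbf{g}]=0$ (Schouten bracket). Writing $K^{1^p2^q}$ ($p+q=n$) for the component with $p$ indices equal to $1$ and $q$ equal to $2$, this means $\partial_tK^{1^n}=0$, $\partial_xK^{2^n}=0$ and $(n-p+1)\,\partial_xK^{1^p2^{n-p}}=p\,\partial_tK^{1^{p-1}2^{n-p+1}}$ for $1\le p\le n$. These tensors form a vector space $\mathcal{K}^n(\mathbb{R}^2_1)$ of dimension $\frac12(n+1)(n+2)$, whose general element is $$K^{1^p2^q}(t,x)=\sum_{i=0}^{p}\sum_{j=0}^{q}\binom{p}{i}\binom{q}{j}\,c_{i,j}\,x^{p-i}t^{q-j},\qquad p+q=n,$$ with arbitrary real parameters $c_{i,j}$, $i,j\ge0$, $i+j\le n$. The parameter space $\Sigma\cong\mathbb{R}^{(n+1)(n+2)/2}$ is the space of these parameters. (In another labelling, $a^s_m=c_{n-s+1-m,\,s-1}$ for $1\le s\le\lfloor n/2\rfloor+1$, $0\le m\le n-2s+2$, and $b^s_m=c_{s-1,\,n-s+1-m}$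 for $1\le s\le\lfloor (n+1)/2\rfloor$, $0\le m\le n-2s+1$.) $I(\mathbb{R}^2_1)$ acts on $\mathcal{K}^n(\mathbb{R}^2_1)$, hence on $\Sigma$, by the usual transformation law (push-forward) of contravariant tensors. For a Killing vector $\mathbf{Y}$ and the general element $\mathbf{K}$ with parameters $c=(c_{i,j})$, the Lie derivative $\mathcal{L}_{\mathbf{Y}}\mathbf{K}$ is again in $\mathcal{K}^n(\mathbb{R}^2_1)$, with parameters $c^0_{i,j}(c)$; $\pi\mathcal{L}_{\mathbf{Y}}\mathbf{K}$ denotes the vector field $\sum c^0_{i,j}(c)\,\partial/\partial c_{i,j}$ on $\Sigma$. (It equals minus the derivative at $s=0$ of the push-forward action of the flow of $\mathbf{Y}$ on $\Sigma$.) The infinitesimal generators of the action on $\Sigma$ are the vector fields obtained in this way from a basis of Killing vectors. *)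

theory Defs
  imports "HOL-Analysis.Analysis"
begin

text \<open>A point of the Minkowski plane is \<^term>\<open>z :: real ^ 2\<close> with \<^term>\<open>z $ 1\<close> = t
  and \<^term>\<open>z $ 2\<close> = x.  A contravariant tensor field K of valence n is given by its components:
  \<^term>\<open>K z I\<close> is the component with multi-index I at z, where I is a list of length n.
  Components at lists of any other length are set to 0, so that equality of functions is
  equality of tensor fields.\<close>

type_synonym plane = "real ^ 2"
type_synonym tensor_field = "plane \<Rightarrow> 2 list \<Rightarrow> real"

definition partial_d :: "2 \<Rightarrow> (plane \<Rightarrow> real) \<Rightarrow> plane \<Rightarrow> real" where
  "partial_d k f z = frechet_derivative f (at z) (axis k 1)"

definition smooth_fn :: "(plane \<Rightarrow> real) \<Rightarrow> bool" where
  "smooth_fn f \<longleftrightarrow> (\<forall>ks. foldr partial_d ks f differentiable_on UNIV)"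

definition symmetric_tensor_field :: "nat \<Rightarrow> tensor_field \<Rightarrow> bool" where
  "symmetric_tensor_field n K \<longleftrightarrow>
     (\<forall>z I. length I \<noteq> n \<longrightarrow> K z I = 0) \<and>
     (\<forall>I. smooth_fn (\<lambda>z. K z I)) \<and>
     (\<forall>z I J. mset I = mset J \<longrightarrow> K z I = K z J)"

definition mink_metric :: tensor_field where
  "mink_metric z I = (if I = [1, 1] then 1 else if I = [2, 2] then - 1 else 0)"

definition symmetrize :: "(2 list \<Rightarrow> real) \<Rightarrow> 2 list \<Rightarrow> real" where
  "symmetrize S I =
     (\<Sum>\<pi> | \<pi> permutes {..<length I}. S (permute_list \<pi> I)) / fact (length I)"

text \<open>The Schouten bracket of symmetric tensor fields of valences p and q (with p + q > 0),
  \[ [P,Q]^{i_1 \dots i_{p+q-1}} =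
       p\, P^{k (i_1 \dots i_{p-1}} \partial_k Q^{i_p \dots i_{p+q-1})}
     - q\, Q^{k (i_1 \dots i_{q-1}} \partial_k P^{i_q \dots i_{p+q-1})}, \]
  with round brackets for symmetrization over the indices i.\<close>

definition schouten :: "nat \<Rightarrow> nat \<Rightarrow> tensor_field \<Rightarrow> tensor_field \<Rightarrow> tensor_field" where
  "schouten p q P Q z I =
     (if length I = p + q - 1 then
        real p * symmetrize (\<lambda>I. \<Sum>k\<in>UNIV.
          P z (k # take (p - 1) I) * partial_d k (\<lambda>w. Q w (drop (p - 1) I)) z) I
      - real q * symmetrize (\<lambda>I. \<Sum>k\<in>UNIV.
          Q z (k # take (q - 1) I) * partial_d k (\<lambda>w. P w (drop (q - 1) I)) z) I
      else 0)"

definition killing_tensors :: "nat \<Rightarrow> tensor_field set" where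
  "killing_tensors n =
     {K. symmetric_tensor_field n K \<and> schouten n 2 K mink_metric = (\<lambda>z I. 0)}"

definition vector_tensor :: "(plane \<Rightarrow> plane) \<Rightarrow> tensor_field" where
  "vector_tensor Y z I = (if length I = 1 then Y z $ hd I else 0)"

definition killing_vector :: "(plane \<Rightarrow> plane) \<Rightarrow> bool" where
  "killing_vector Y \<longleftrightarrow> vector_tensor Y \<in> killing_tensors 1"

definition killing_vector_basis ::
  "(plane \<Rightarrow> plane) \<Rightarrow> (plane \<Rightarrow> plane) \<Rightarrow> (plane \<Rightarrow> plane) \<Rightarrow> bool" where
  "killing_vector_basis Y1 Y2 Y3 \<longleftrightarrow>
     killing_vector Y1 \<and> killing_vector Y2 \<and> killing_vector Y3 \<and>
     (\<forall>Y. killing_vector Y \<longrightarrow>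
        (\<exists>!(a, b, d). Y = (\<lambda>z. a *\<^sub>R Y1 z + b *\<^sub>R Y2 z + d *\<^sub>R Y3 z)))"

definition vf_T :: "plane \<Rightarrow> plane" where "vf_T z = vector [1, 0]"
definition vf_X :: "plane \<Rightarrow> plane" where "vf_X z = vector [0, 1]"
definition vf_H :: "plane \<Rightarrow> plane" where "vf_H z = vector [z $ 2, z $ 1]"

definition lie_derivative :: "(plane \<Rightarrow> plane) \<Rightarrow> tensor_field \<Rightarrow> tensor_field" where
  "lie_derivative Y K z I =
     (\<Sum>k\<in>UNIV. Y z $ k * partial_d k (\<lambda>w. K w I) z)
   - (\<Sum>r<length I. \<Sum>k\<in>UNIV. partial_d k (\<lambda>w. Y w $ (I ! r)) z * K z (I[r := k]))"

text \<open>Parameters are families c of reals indexed by i, j with i + j \<open>\<le>\<close> n, extended by 0.\<close>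

definition param_space :: "nat \<Rightarrow> (nat \<Rightarrow> nat \<Rightarrow> real) set" where
  "param_space n = {c. \<forall>i j. i + j > n \<longrightarrow> c i j = 0}"

definition killing_tensor :: "nat \<Rightarrow> (nat \<Rightarrow> nat \<Rightarrow> real) \<Rightarrow> tensor_field" where
  "killing_tensor n c z I =
     (if length I = n then
        let p = count_list I 1; q = count_list I 2 in
        \<Sum>i\<le>p. \<Sum>j\<le>q. real (p choose i) * real (q choose j) * c i j
           * (z $ 2) ^ (p - i) * (z $ 1) ^ (q - j)
      else 0)"

definition killing_params :: "nat \<Rightarrow> tensor_field \<Rightarrow> nat \<Rightarrow> nat \<Rightarrow> real" where
  "killing_params n = inv_into (param_space n) (killing_tensor n)"

text \<open>A vector field on the parameter space sends a parameter family to the family of its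
  components; \<open>coord_field i j\<close> is the (constant) coordinate field along \<open>c\<^sub>i\<^sub>j\<close>.\<close>

definition coord_field :: "nat \<Rightarrow> nat \<Rightarrow> nat \<Rightarrow> nat \<Rightarrow> real" where
  "coord_field i j = (\<lambda>k l. if k = i \<and> l = j then 1 else 0)"

definition pi_lie ::
  "nat \<Rightarrow> (plane \<Rightarrow> plane) \<Rightarrow> (nat \<Rightarrow> nat \<Rightarrow> real) \<Rightarrow> nat \<Rightarrow> nat \<Rightarrow> real" where
  "pi_lie n Y c = killing_params n (lie_derivative Y (killing_tensor n c))"

definition mink_isom :: "real \<Rightarrow> real \<Rightarrow> real \<Rightarrow> plane \<Rightarrow> plane" where
  "mink_isom \<phi> a b z =
     vector [z $ 1 * cosh \<phi> + z $ 2 * sinh \<phi> + a, z $ 1 * sinh \<phi> + z $ 2 * cosh \<phi> + b]"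

definition isom_group :: "(plane \<Rightarrow> plane) set" where
  "isom_group = {mink_isom \<phi> a b | \<phi> a b. True}"

definition pushforward :: "(plane \<Rightarrow> plane) \<Rightarrow> tensor_field \<Rightarrow> tensor_field" where
  "pushforward f K z I =
     (\<Sum>J | length J = length I.
        (\<Prod>r<length I. partial_d (J ! r) (\<lambda>w. f w $ (I ! r)) (inv f z)) * K (inv f z) J)"

definition param_action ::
  "nat \<Rightarrow> (plane \<Rightarrow> plane) \<Rightarrow> (nat \<Rightarrow> nat \<Rightarrow> real) \<Rightarrow> nat \<Rightarrow> nat \<Rightarrow> real" where
  "param_action n f c = killing_params n (pushforward f (killing_tensor n c))"

definition is_flow :: "(plane \<Rightarrow> plane) \<Rightarrow> (real \<Rightarrow> plane \<Rightarrow> plane) \<Rightarrow> bool" where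
  "is_flow Y \<theta> \<longleftrightarrow> (\<forall>z. \<theta> 0 z = z) \<and>
     (\<forall>s z. ((\<lambda>s. \<theta> s z) has_vector_derivative Y (\<theta> s z)) (at s))"

text \<open>Sign convention: V generates the action along Y if it is minus the velocity at s = 0 of the
  push-forward along the flow of Y, in accordance with the Lie derivative being minus that
  velocity.\<close>

definition generates_action ::
  "nat \<Rightarrow> (plane \<Rightarrow> plane) \<Rightarrow> ((nat \<Rightarrow> nat \<Rightarrow> real) \<Rightarrow> nat \<Rightarrow> nat \<Rightarrow> real) \<Rightarrow> bool" where
  "generates_action n Y V \<longleftrightarrow>
     (\<exists>\<theta>. is_flow Y \<theta> \<and> (\<forall>s. \<theta> s \<in> isom_group) \<and>
       (\<forall>c\<in>param_space n. \<forall>i j.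
          ((\<lambda>s. param_action n (\<theta> s) c i j) has_real_derivative - V c i j) (at 0)))"

end

theory Submission
  imports Defs
begin

text \<open>The components of a Killing tensor with parameters \<open>c\<close> are umbral powers:
  \<open>K\<^bsub>p,q\<^esub> = L\<^sub>c ((\<alpha> + x)\<^sup>p (\<beta> + t)\<^sup>q)\<close>, where the linear functional \<open>L\<^sub>c\<close> sends
  \<open>\<alpha>\<^sup>i \<beta>\<^sup>j\<close> to \<open>c\<^bsub>i,j\<^esub>\<close>.  An isometry acts on such a power by an affine substitution in \<open>\<alpha>\<close> and \<open>\<beta>\<close>, so
  its effect on the parameters is \<open>c\<^bsub>i,j\<^esub> \<mapsto> L\<^sub>c (A\<^sup>i B\<^sup>j)\<close> with
  \<open>A = \<alpha> cosh \<phi> + \<beta> sinh \<phi> - b\<close> and \<open>B = \<alpha> sinh \<phi> + \<beta> cosh \<phi> - a\<close>.  Differentiating in the group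
  parameter gives the generators, and differentiating the same identity for the components
  identifies them with the Lie derivative.\<close>

section \<open>Partial derivatives\<close>

lemma partial_d_eqI:
  assumes "(f has_derivative f') (at z)"
  shows "partial_d k f z = f' (axis k 1)"
  using frechet_derivative_at[OF assms] by (simp add: partial_d_def)

lemma has_derivative_partial_d:
  assumes "f differentiable (at z)"
  shows "(f has_derivative (\<lambda>v. v $ 1 * partial_d 1 f z + v $ 2 * partial_d 2 f z)) (at z)"
proof -
  let ?D = "frechet_derivative f (at z)"
  have D: "(f has_derivative ?D) (at z)"
    using assms by (simp add: frechet_derivative_works)
  then interpret linear ?D
    by (rule has_derivative_linear)
  have "?D v = v $ 1 * partial_d 1 f z + v $ 2 * partial_d 2 f z" for v
  proof -
    have "v = (v $ 1) *\<^sub>R axis 1 1 + (v $ 2) *\<^sub>R axis 2 1"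
      by (simp add: vec_eq_iff forall_2 axis_def)
    then have "?D v = ?D ((v $ 1) *\<^sub>R axis 1 1 + (v $ 2) *\<^sub>R axis 2 1)"
      by (rule arg_cong)
    then show ?thesis
      by (simp add: add scale partial_d_def)
  qed
  then have "?D = (\<lambda>v. v $ 1 * partial_d 1 f z + v $ 2 * partial_d 2 f z)"
    by (rule ext)
  with D show ?thesis by simp
qed

lemma partial_d_const [simp]: "partial_d k (\<lambda>z. r) z = 0"
  by (rule partial_d_eqI[THEN trans], rule has_derivative_const) simp

lemma partial_d_cmult:
  assumes "f differentiable (at z)"
  shows "partial_d k (\<lambda>w. r * f w) z = r * partial_d k f z"
  using partial_d_eqI[OF has_derivative_mult_right[OF has_derivative_partial_d[OF assms]], of k r]
    partial_d_eqI[OF has_derivative_partial_d[OF assms], of k]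
  by simp

lemma partial_d_DERIV:
  assumes "f differentiable (at (w + s *\<^sub>R axis k 1))"
  shows "((\<lambda>s. f (w + s *\<^sub>R axis k 1)) has_real_derivative
           partial_d k f (w + s *\<^sub>R axis k 1)) (at s)"
proof -
  let ?D = "frechet_derivative f (at (w + s *\<^sub>R axis k 1))"
  have D: "(f has_derivative ?D) (at (w + s *\<^sub>R axis k 1))"
    using assms by (simp add: frechet_derivative_works)
  have "((\<lambda>s. w + s *\<^sub>R axis k 1) has_derivative (\<lambda>h. h *\<^sub>R axis k 1)) (at s)"
    by (auto intro!: derivative_eq_intros)
  from diff_chain_at[OF this D] 
  have "((\<lambda>s. f (w + s *\<^sub>R axis k 1)) has_derivative (\<lambda>h. ?D (h *\<^sub>R axis k 1))) (at s)"
    by (simp add: o_def)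
  moreover have "?D (h *\<^sub>R axis k 1) = partial_d k f (w + s *\<^sub>R axis k 1) * h" for h
    using linear_scale[OF has_derivative_linear[OF D]] by (simp add: partial_d_def)
  ultimately show ?thesis
    by (simp add: has_field_derivative_def)
qed

section \<open>Smooth functions and the symmetry of their second partial derivatives\<close>

lemma smooth_fn_differentiable: "smooth_fn f \<Longrightarrow> f differentiable (at z)"
  unfolding smooth_fn_def differentiable_on_def
  by (drule spec[of _ "[]"]) simp

lemma smooth_fn_partial_d: "smooth_fn (partial_d k f)" if "smooth_fn f"
  unfolding smooth_fn_def
proof
  fix ks
  show "foldr partial_d ks (partial_d k f) differentiable_on UNIV"
    using that[unfolded smooth_fn_def, rule_format, of "ks @ [k]"] by simp
qed

lemma smooth_fn_cmult:
  assumes "smooth_fn f"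
  shows "smooth_fn (\<lambda>z. r * f z)"
proof -
  have "foldr partial_d ks (\<lambda>z. r * f z) = (\<lambda>z. r * foldr partial_d ks f z) \<and>
        smooth_fn (foldr partial_d ks f)" for ks
  proof (induction ks)
    case (Cons k ks)
    have "partial_d k (\<lambda>w. r * foldr partial_d ks f w) z = r * partial_d k (foldr partial_d ks f) z" for z
      using Cons by (intro partial_d_cmult smooth_fn_differentiable) simp
    then show ?case
      using Cons by (simp add: smooth_fn_partial_d)
  qed (use assms in simp)
  then show ?thesis
    unfolding smooth_fn_def[of "\<lambda>z. r * f z"]
    by (auto simp: differentiable_on_def intro!: differentiable_mult smooth_fn_differentiable)
qed

text \<open>The mean value theorem is applied twice, first along axis k to the increment
  \<open>\<phi>\<close>, then along axis l to \<open>partial_d k f\<close>. The left side is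
  symmetric in k and l while the right side names one order of differentiation, so the two instances
  can be compared.\<close>

lemma second_difference_mvt:
  fixes h :: real
  assumes f: "smooth_fn f" and h: "h > 0"
  shows "\<exists>s r. 0 < s \<and> s < h \<and> 0 < r \<and> r < h \<and>
    f (z + h *\<^sub>R axis k 1 + h *\<^sub>R axis l 1) - f (z + h *\<^sub>R axis k 1) - f (z + h *\<^sub>R axis l 1) + f z
     = h * h * partial_d l (partial_d k f) (z + s *\<^sub>R axis k 1 + r *\<^sub>R axis l 1)"
proof -
  let ?e = "axis k 1 :: plane" and ?e' = "axis l 1 :: plane"
  define \<phi> where "\<phi> s = f ((z + h *\<^sub>R ?e') + s *\<^sub>R ?e) - f (z + s *\<^sub>R ?e)" for s
  have "(\<phi> has_real_derivative partial_d k f ((z + h *\<^sub>R ?e') + s *\<^sub>R ?e)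
          - partial_d k f (z + s *\<^sub>R ?e)) (at s)" for s
    unfolding \<phi>_def by (intro DERIV_diff partial_d_DERIV smooth_fn_differentiable f)
  then have "\<exists>s>0. s < h \<and> \<phi> h - \<phi> 0 = (h - 0) *
      (partial_d k f ((z + h *\<^sub>R ?e') + s *\<^sub>R ?e) - partial_d k f (z + s *\<^sub>R ?e))"
    by (intro MVT2[OF h])
  then obtain s where s: "0 < s" "s < h" and
    "\<phi> h - \<phi> 0 = (h - 0) * (partial_d k f ((z + h *\<^sub>R ?e') + s *\<^sub>R ?e) - partial_d k f (z + s *\<^sub>R ?e))"
    by blast
  then have *: "\<phi> h - \<phi> 0 =
      h * (partial_d k f ((z + s *\<^sub>R ?e) + h *\<^sub>R ?e') - partial_d k f ((z + s *\<^sub>R ?e) + 0 *\<^sub>R ?e'))"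
    by (simp add: algebra_simps)
  have "((\<lambda>r. partial_d k f ((z + s *\<^sub>R ?e) + r *\<^sub>R ?e')) has_real_derivative
          partial_d l (partial_d k f) ((z + s *\<^sub>R ?e) + r *\<^sub>R ?e')) (at r)" for r
    by (intro partial_d_DERIV smooth_fn_differentiable smooth_fn_partial_d f)
  then have "\<exists>r>0. r < h \<and>
      partial_d k f ((z + s *\<^sub>R ?e) + h *\<^sub>R ?e') - partial_d k f ((z + s *\<^sub>R ?e) + 0 *\<^sub>R ?e')
      = (h - 0) * partial_d l (partial_d k f) ((z + s *\<^sub>R ?e) + r *\<^sub>R ?e')"
    by (intro MVT2[OF h])
  then obtain r where r: "0 < r" "r < h" and
    "partial_d k f ((z + s *\<^sub>R ?e) + h *\<^sub>R ?e') - partial_d k f ((z + s *\<^sub>R ?e) + 0 *\<^sub>R ?e')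
      = (h - 0) * partial_d l (partial_d k f) ((z + s *\<^sub>R ?e) + r *\<^sub>R ?e')"
    by blast
  with * have "\<phi> h - \<phi> 0 = h * h * partial_d l (partial_d k f) (z + s *\<^sub>R ?e + r *\<^sub>R ?e')"
    by simp
  moreover have "\<phi> h - \<phi> 0 = f (z + h *\<^sub>R ?e + h *\<^sub>R ?e') - f (z + h *\<^sub>R ?e) - f (z + h *\<^sub>R ?e') + f z"
    by (simp add: \<phi>_def algebra_simps)
  ultimately show ?thesis using s r by metis
qed

lemma partial_d_commute:
  assumes f: "smooth_fn f"
  shows "partial_d k (partial_d l f) z = partial_d l (partial_d k f) z"
proof (rule ccontr)
  assume neq: "partial_d k (partial_d l f) z \<noteq> partial_d l (partial_d k f) z"
  \<comment> \<open>Half the gap: two values within \<open>e\<close> of the two distinct mixed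
    partials, respectively, cannot coincide.\<close>
  define e where "e = \<bar>partial_d k (partial_d l f) z - partial_d l (partial_d k f) z\<bar> / 2"
  have e: "e > 0" using neq by (simp add: e_def)
  have cont: "isCont (partial_d k (partial_d l f)) z" "isCont (partial_d l (partial_d k f)) z"
    by (intro differentiable_imp_continuous_within smooth_fn_differentiable smooth_fn_partial_d f)+
  obtain d1 where d1: "d1 > 0" "\<And>w. dist w z < d1 \<Longrightarrow>
      \<bar>partial_d k (partial_d l f) w - partial_d k (partial_d l f) z\<bar> < e"
    using cont(1) e unfolding continuous_at_eps_delta dist_real_def by blast
  obtain d2 where d2: "d2 > 0" "\<And>w. dist w z < d2 \<Longrightarrow>
      \<bar>partial_d l (partial_d k f) w - partial_d l (partial_d k f) z\<bar> < e"
    using cont(2) e unfolding continuous_at_eps_delta dist_real_def by blast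
  \<comment> \<open>Any point reached by steps \<open>s\<close> and \<open>r\<close> below
    \<open>h\<close> then lies within \<open>2 * h = min d1 d2\<close> of \<open>z\<close>.\<close>
  define h where "h = min d1 d2 / 2"
  have h: "h > 0" using d1 d2 by (simp add: h_def)
  have near: "dist (z + s *\<^sub>R axis i 1 + r *\<^sub>R axis j 1) z < min d1 d2"
    if "0 < s" "s < h" "0 < r" "r < h" for s r :: real and i j :: 2
  proof -
    have "dist (z + s *\<^sub>R axis i 1 + r *\<^sub>R axis j 1) z = norm (s *\<^sub>R axis i 1 + r *\<^sub>R axis j 1 :: plane)"
      by (simp add: dist_norm add.assoc)
    also have "\<dots> \<le> s + r"
      using norm_triangle_ineq[of "s *\<^sub>R axis i 1 :: plane" "r *\<^sub>R axis j 1"] that by (simp add: norm_axis_1)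
    also have "\<dots> < min d1 d2" using that by (simp add: h_def)
    finally show ?thesis .
  qed
  obtain s r where sr: "0 < s" "s < h" "0 < r" "r < h" and
    1: "f (z + h *\<^sub>R axis k 1 + h *\<^sub>R axis l 1) - f (z + h *\<^sub>R axis k 1) - f (z + h *\<^sub>R axis l 1) + f z
     = h * h * partial_d l (partial_d k f) (z + s *\<^sub>R axis k 1 + r *\<^sub>R axis l 1)"
    using second_difference_mvt[OF f h, of z k l] by blast
  obtain s' r' where sr': "0 < s'" "s' < h" "0 < r'" "r' < h" and
    2: "f (z + h *\<^sub>R axis l 1 + h *\<^sub>R axis k 1) - f (z + h *\<^sub>R axis l 1) - f (z + h *\<^sub>R axis k 1) + f z
     = h * h * partial_d k (partial_d l f) (z + s' *\<^sub>R axis l 1 + r' *\<^sub>R axis k 1)"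
    using second_difference_mvt[OF f h, of z l k] by blast
  have "f (z + h *\<^sub>R axis l 1 + h *\<^sub>R axis k 1) = f (z + h *\<^sub>R axis k 1 + h *\<^sub>R axis l 1)"
    by (simp add: add_ac)
  with 1 2 have "h * h * partial_d l (partial_d k f) (z + s *\<^sub>R axis k 1 + r *\<^sub>R axis l 1) =
      h * h * partial_d k (partial_d l f) (z + s' *\<^sub>R axis l 1 + r' *\<^sub>R axis k 1)"
    by linarith
  then have "partial_d l (partial_d k f) (z + s *\<^sub>R axis k 1 + r *\<^sub>R axis l 1) =
      partial_d k (partial_d l f) (z + s' *\<^sub>R axis l 1 + r' *\<^sub>R axis k 1)"
    using h by simp
  moreover have "\<bar>partial_d l (partial_d k f) (z + s *\<^sub>R axis k 1 + r *\<^sub>R axis l 1)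
      - partial_d l (partial_d k f) z\<bar> < e"
    using near[OF sr] by (intro d2) auto
  moreover have "\<bar>partial_d k (partial_d l f) (z + s' *\<^sub>R axis l 1 + r' *\<^sub>R axis k 1)
      - partial_d k (partial_d l f) z\<bar> < e"
    using near[OF sr'] by (intro d1) auto
  moreover have False
    if "x = y" "\<bar>x - a\<bar> < \<bar>b - a\<bar> / 2" "\<bar>y - b\<bar> < \<bar>b - a\<bar> / 2" for a b x y :: real
    using that by (auto simp: abs_if split: if_splits)
  ultimately show False
    unfolding e_def by blast
qed

section \<open>The Killing equations for components\<close>

text \<open>With p and q left free of the constraint p + q = n, the family is closed under partial
  differentiation up to scalars, and one formula serves all valences.\<close>

definition killing_comp :: "(nat \<Rightarrow> nat \<Rightarrow> real) \<Rightarrow> nat \<Rightarrow> nat \<Rightarrow> plane \<Rightarrow> real" where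
  "killing_comp c p q z = (\<Sum>i\<le>p. \<Sum>j\<le>q. real (p choose i) * real (q choose j) * c i j
     * (z $ 2) ^ (p - i) * (z $ 1) ^ (q - j))"

text \<open>Termwise this is the absorption identity
  \<open>(p - i) * (p choose i) = p * ((p - 1) choose i)\<close>.\<close>

lemma binomial_sum_deriv:
  fixes x :: real
  shows "(\<Sum>i\<le>p. real (p choose i) * a i * (real (p - i) * x ^ (p - i - 1))) =
    real p * (\<Sum>i\<le>p - 1. real ((p - 1) choose i) * a i * x ^ (p - 1 - i))"
proof (cases p)
  case (Suc m)
  have "real (p choose i) * a i * (real (p - i) * x ^ (p - i - 1)) =
      real p * (real (m choose i) * a i * x ^ (m - i))" for i
  proof -
    have "real (p - i) * real (p choose i) = real p * real (m choose i)"
      using binomial_absorb_comp[of p i] unfolding of_nat_mult[symmetric] Suc by simp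
    then have "(real (p - i) * real (p choose i)) * (a i * x ^ (m - i)) =
        (real p * real (m choose i)) * (a i * x ^ (m - i))"
      by (rule arg_cong)
    moreover have "p - i - 1 = m - i" by (simp add: Suc)
    ultimately show ?thesis
      by (simp only: mult_ac)
  qed
  note * = this
  have "(\<Sum>i\<le>p. real (p choose i) * a i * (real (p - i) * x ^ (p - i - 1))) =
      (\<Sum>i\<le>p. real p * (real (m choose i) * a i * x ^ (m - i)))"
    by (intro sum.cong refl *)
  \<comment> \<open>The term i = p disappears because \<open>m choose Suc m\<close> is 0.\<close>
  also have "\<dots> = real p * (\<Sum>i\<le>m. real (m choose i) * a i * x ^ (m - i))"
    by (simp add: Suc sum_distrib_left)
  finally show ?thesis
    by (simp add: Suc)
qed simp

text \<open>Each derivative lowers one index, as for Appell polynomials; at index 0 the truncated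
  predecessor is multiplied by 0.\<close>

lemma has_derivative_killing_comp:
  "(killing_comp c p q has_derivative
     (\<lambda>v. v $ 1 * (real q * killing_comp c p (q - 1) z) + v $ 2 * (real p * killing_comp c (p - 1) q z)))
     (at z)"
proof -
  let ?b = "\<lambda>i j. real (p choose i) * real (q choose j) * c i j"
  have "(killing_comp c p q has_derivative (\<lambda>v. \<Sum>i\<le>p. \<Sum>j\<le>q.
      ?b i j * (z $ 2) ^ (p - i) * (real (q - j) * (v $ 1) * (z $ 1) ^ (q - j - 1)) +
      ?b i j * (real (p - i) * (v $ 2) * (z $ 2) ^ (p - i - 1)) * (z $ 1) ^ (q - j))) (at z)"
    unfolding killing_comp_def[abs_def]
    by (intro has_derivative_sum has_derivative_mult has_derivative_mult_right has_derivative_power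
        bounded_linear_imp_has_derivative bounded_linear_vec_nth)
  moreover have "(\<Sum>i\<le>p. \<Sum>j\<le>q. ?b i j * (z $ 2) ^ (p - i) * (real (q - j) * (v $ 1) * (z $ 1) ^ (q - j - 1)))
      = v $ 1 * (real q * killing_comp c p (q - 1) z)" for v :: plane
  proof -
    have "(\<Sum>j\<le>q. ?b i j * (z $ 2) ^ (p - i) * (real (q - j) * (v $ 1) * (z $ 1) ^ (q - j - 1))) =
       v $ 1 * real (p choose i) * (z $ 2) ^ (p - i) *
       (\<Sum>j\<le>q. real (q choose j) * c i j * (real (q - j) * (z $ 1) ^ (q - j - 1)))" for i
      unfolding sum_distrib_left by (intro sum.cong refl) (simp only: mult_ac)
    then show ?thesis
      unfolding binomial_sum_deriv by (simp add: killing_comp_def sum_distrib_left mult_ac)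
  qed
  moreover have "(\<Sum>i\<le>p. \<Sum>j\<le>q. ?b i j * (real (p - i) * (v $ 2) * (z $ 2) ^ (p - i - 1)) * (z $ 1) ^ (q - j))
      = v $ 2 * (real p * killing_comp c (p - 1) q z)" for v :: plane
  proof -
    have "(\<Sum>i\<le>p. ?b i j * (real (p - i) * (v $ 2) * (z $ 2) ^ (p - i - 1)) * (z $ 1) ^ (q - j)) =
       v $ 2 * real (q choose j) * (z $ 1) ^ (q - j) *
       (\<Sum>i\<le>p. real (p choose i) * c i j * (real (p - i) * (z $ 2) ^ (p - i - 1)))" for j
      unfolding sum_distrib_left by (intro sum.cong refl) (simp only: mult_ac)
    then show ?thesis
      unfolding binomial_sum_deriv killing_comp_def
      by (subst (1 2) sum.swap) (simp add: sum_distrib_left mult_ac)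
  qed
  ultimately show ?thesis
    by (simp add: sum.distrib)
qed

lemma partial_d_killing_comp:
  "partial_d 1 (killing_comp c p q) = (\<lambda>z. real q * killing_comp c p (q - 1) z)"
  "partial_d 2 (killing_comp c p q) = (\<lambda>z. real p * killing_comp c (p - 1) q z)"
  using partial_d_eqI[OF has_derivative_killing_comp[of c p q]]
  by (simp_all add: fun_eq_iff axis_def)

text \<open>Every iterated partial derivative is a scalar multiple of some
  \<open>killing_comp c p' q'\<close>, hence differentiable.\<close>

lemma smooth_fn_killing_comp: "smooth_fn (killing_comp c p q)"
proof -
  have diff: "killing_comp c p q differentiable (at z)" for p q z
    using has_derivative_killing_comp unfolding differentiable_def by blast
  have "\<exists>r p' q'. foldr partial_d ks (killing_comp c p q) = (\<lambda>z. r * killing_comp c p' q' z)" for ks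
  proof (induction ks)
    case Nil
    show ?case by (rule exI[of _ 1]) auto
  next
    case (Cons k ks)
    then obtain r p' q' where
      "foldr partial_d ks (killing_comp c p q) = (\<lambda>z. r * killing_comp c p' q' z)"
      by blast
    then have *: "foldr partial_d (k # ks) (killing_comp c p q) = (\<lambda>z. r * partial_d k (killing_comp c p' q') z)"
      by (simp only: foldr_Cons comp_apply partial_d_cmult[OF diff, abs_def])
    consider "k = 1" | "k = 2" using exhaust_2 by blast
    then show ?case
    proof cases
      case 1
      show ?thesis
        by (rule exI[of _ "r * real q'"], rule exI[of _ p'], rule exI[of _ "q' - 1"])
          (subst *, simp add: 1 partial_d_killing_comp mult.assoc)
    next
      case 2
      show ?thesis
        by (rule exI[of _ "r * real p'"], rule exI[of _ "p' - 1"], rule exI[of _ q'])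
          (subst *, simp add: 2 partial_d_killing_comp mult.assoc)
    qed
  qed
  note * = this
  show ?thesis
    unfolding smooth_fn_def
  proof
    fix ks
    obtain r p' q' where "foldr partial_d ks (killing_comp c p q) = (\<lambda>z. r * killing_comp c p' q' z)"
      using * by blast
    then show "foldr partial_d ks (killing_comp c p q) differentiable_on UNIV"
      by (simp add: differentiable_on_def diff)
  qed
qed

section \<open>Uniqueness of the parameters and solution of the Killing equations\<close>

lemma double_sum_single:
  fixes f :: "nat \<Rightarrow> nat \<Rightarrow> 'a :: comm_monoid_add"
  assumes "\<And>i j. i \<le> p \<Longrightarrow> j \<le> q \<Longrightarrow> (i, j) \<noteq> (p, q) \<Longrightarrow> f i j = 0"
  shows "(\<Sum>i\<le>p. \<Sum>j\<le>q. f i j) = f p q"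
proof -
  have "(\<Sum>i\<le>p. \<Sum>j\<le>q. f i j) = (\<Sum>(i, j)\<in>{(p, q)}. f i j)"
    unfolding sum.cartesian_product using assms by (intro sum.mono_neutral_right) auto
  then show ?thesis by simp
qed

lemma killing_comp_0: "killing_comp c p q 0 = c p q"
  unfolding killing_comp_def by (subst double_sum_single) (auto simp: power_0_left)

lemma killing_comp_add:
  "killing_comp (\<lambda>i j. c i j + d i j) p q z = killing_comp c p q z + killing_comp d p q z"
  by (simp add: killing_comp_def algebra_simps sum.distrib)

lemma killing_comp_diff:
  "killing_comp (\<lambda>i j. c i j - d i j) p q z = killing_comp c p q z - killing_comp d p q z"
  by (simp add: killing_comp_def algebra_simps sum_subtractf)

text \<open>The t-derivative of the (p, q + 1) component is q + 1 times the (p, q) component, so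
  vanishing descends from n + 1 to n. The parameters of top degree are values at the origin.\<close>

lemma killing_comp_eq_0_imp:
  assumes "\<And>p q. p + q = n \<Longrightarrow> killing_comp c p q = (\<lambda>z. 0)" "i + j \<le> n"
  shows "c i j = 0"
  using assms
proof (induction n)
  case 0
  then show ?case using killing_comp_0[of c 0 0] by simp
next
  case (Suc n)
  have "killing_comp c p q = (\<lambda>z. 0)" if "p + q = n" for p q
  proof -
    have "partial_d 1 (killing_comp c p (Suc q)) = (\<lambda>z. 0)"
      using Suc.prems(1)[of p "Suc q"] that by (simp add: partial_d_const[abs_def])
    then show ?thesis by (simp add: partial_d_killing_comp fun_eq_iff)
  qed
  then show ?case
    using Suc.IH Suc.prems killing_comp_0[of c i j] by (cases "i + j = Suc n") auto
qed

lemma partial_d_zero_imp_const: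
  assumes "\<And>z. f differentiable (at z)" "\<And>k z. partial_d k f z = 0"
  shows "f z = f 0"
proof -
  have "(f has_derivative (\<lambda>v. 0)) (at w within UNIV)" for w
    using has_derivative_partial_d[OF assms(1)] by (simp add: assms(2))
  then show ?thesis
    using has_derivative_zero_unique[of UNIV f z 0] by simp
qed

text \<open>The families \<open>\<partial>\<^sub>t k\<^bsub>p,q\<^esub> / q\<close> and \<open>\<partial>\<^sub>x k\<^bsub>p,q\<^esub> / p\<close> come from a single solution \<open>k'\<close> of the equations for
  \<open>n - 1\<close>, as \<open>k'\<^bsub>p,q-1\<^esub>\<close> and \<open>k'\<^bsub>p-1,q\<^esub>\<close>.  So induction determines the components up to additive
  constants, which are the parameters with \<open>i + j = n\<close>.\<close>

lemma killing_equations_solution: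
  assumes "\<And>p q. p + q = n \<Longrightarrow> smooth_fn (k p q)"
    and "\<And>p q z. p + q = Suc n \<Longrightarrow>
      real p * partial_d 1 (k (p - 1) q) z = real q * partial_d 2 (k p (q - 1)) z"
  shows "\<exists>c\<in>param_space n. \<forall>p q. p + q = n \<longrightarrow> k p q = killing_comp c p q"
  using assms
proof (induction n arbitrary: k)
  case 0
  have "partial_d l (k 0 0) z = 0" for l z
    using 0(2)[of 1 0 z] 0(2)[of 0 1 z] exhaust_2[of l] by auto
  then have "k 0 0 z = k 0 0 0" for z
    using 0(1) by (intro partial_d_zero_imp_const smooth_fn_differentiable) auto
  then show ?case
    by (intro bexI[of _ "\<lambda>i j. if i + j = 0 then k 0 0 0 else 0"])
      (auto simp: killing_comp_def param_space_def fun_eq_iff)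
next
  case (Suc n)
  \<comment> \<open>Division by q + 1 undoes the factor that differentiation in t produces on
    \<open>killing_comp\<close>.\<close>
  define k' where "k' p q z = (1 / real (Suc q)) * partial_d 1 (k p (Suc q)) z" for p q z
  have dt: "partial_d 1 (k p q) = (\<lambda>z. real q * k' p (q - 1) z)" if "p + q = Suc n" for p q
  proof (cases q)
    case 0
    \<comment> \<open>For q = 0 the equation with indices (p + 1, 0) forces this derivative to
      vanish.\<close>
    then show ?thesis using Suc.prems(2)[of "Suc p" 0] that by (auto simp: fun_eq_iff)
  qed (simp add: k'_def fun_eq_iff)
  have dx: "partial_d 2 (k p q) = (\<lambda>z. real p * k' (p - 1) q z)" if "p + q = Suc n" for p q
    using Suc.prems(2)[of p "Suc q"] that
    by (auto simp: k'_def fun_eq_iff field_simps)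
  have sk: "smooth_fn (k' p q)" if "p + q = n" for p q
    unfolding k'_def[abs_def] using that
    by (intro smooth_fn_cmult smooth_fn_partial_d Suc.prems) auto
  have "real p * partial_d 1 (k' (p - 1) q) z = real q * partial_d 2 (k' p (q - 1)) z"
    if "p + q = Suc n" for p q z
  proof -
    have "real p * partial_d 1 (k' (p - 1) q) z = partial_d 1 (\<lambda>z. real p * k' (p - 1) q z) z"
      using that by (cases p) (auto intro!: partial_d_cmult[symmetric] smooth_fn_differentiable sk)
    \<comment> \<open>The symmetry of the mixed partials of \<open>k p q\<close> is the Killing
      equation for \<open>k'\<close>.\<close>
    also have "\<dots> = partial_d 2 (\<lambda>z. real q * k' p (q - 1) z) z"
      using partial_d_commute[OF Suc.prems(1)[OF that], of 1 2 z] by (simp only: dt[OF that] dx[OF that])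
    also have "\<dots> = real q * partial_d 2 (k' p (q - 1)) z"
      using that by (cases q) (auto intro!: partial_d_cmult smooth_fn_differentiable sk)
    finally show ?thesis .
  qed
  from Suc.IH[OF sk this] obtain c where c: "c \<in> param_space n"
    and kc: "\<And>p q. p + q = n \<Longrightarrow> k' p q = killing_comp c p q"
    by blast
  \<comment> \<open>The constants of integration are the values at the origin; they become the
    parameters of degree n + 1, where \<open>c\<close> vanishes.\<close>
  define e where "e i j = (if i + j = Suc n then k i j 0 else 0)" for i j
  have "k p q z = killing_comp (\<lambda>i j. c i j + e i j) p q z" if pq: "p + q = Suc n" for p q z
  proof -
    let ?g = "\<lambda>z. k p q z - killing_comp c p q z"
    have diff: "k p q differentiable (at w)" "killing_comp c p q differentiable (at w)" for w
      using pq by (auto intro!: smooth_fn_differentiable Suc.prems smooth_fn_killing_comp)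
    have eq: "partial_d l (k p q) w = partial_d l (killing_comp c p q) w" for l w
    proof (cases "l = 1")
      case True
      then show ?thesis using pq by (cases q) (simp_all add: dt partial_d_killing_comp kc)
    next
      case False
      then have "l = 2" using exhaust_2 by blast
      then show ?thesis using pq by (cases p) (simp_all add: dx partial_d_killing_comp kc)
    qed
    have "partial_d l ?g w = 0" for l w
      using partial_d_eqI[OF has_derivative_diff[OF has_derivative_partial_d[OF diff(1)] has_derivative_partial_d[OF diff(2)]], of l w]
      by (simp add: eq)
    then have "?g z = ?g 0"
      by (intro partial_d_zero_imp_const differentiable_diff diff)
    moreover have "killing_comp c p q 0 = 0"
      using c pq by (simp add: killing_comp_0 param_space_def)
    \<comment> \<open>Only the term (p, q) of the double sum has total degree n + 1, and both
      coordinates occur in it with power 0.\<close>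
    moreover have "killing_comp e p q z = k p q 0"
      unfolding killing_comp_def using pq
      by (subst double_sum_single) (auto simp: e_def)
    ultimately show ?thesis by (simp add: killing_comp_add)
  qed
  moreover have "(\<lambda>i j. c i j + e i j) \<in> param_space (Suc n)"
    using c by (auto simp: param_space_def e_def)
  ultimately show ?case by (intro bexI[of _ "\<lambda>i j. c i j + e i j"]) (auto simp: fun_eq_iff)
qed

section \<open>Killing tensors and their parameters\<close>

lemma count_list_1_2: "count_list I 1 + count_list I (2 :: 2) = length I"
proof (induction I)
  case (Cons h I)
  then show ?case using exhaust_2[of h] by auto
qed simp

lemma mset_2_eq_iff:
  fixes I J :: "2 list"
  shows "mset I = mset J \<longleftrightarrow> count_list I 1 = count_list J 1 \<and> count_list I 2 = count_list J 2"
  by (simp add: multiset_eq_iff forall_2 count_mset)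

lemma count_list_replicate: "count_list (replicate m x) y = (if x = y then m else 0)"
  by (induction m) auto

lemma sum_nth_2:
  fixes G :: "2 \<Rightarrow> real"
  shows "(\<Sum>m<length I. G (I ! m)) = real (count_list I 1) * G 1 + real (count_list I 2) * G 2"
proof (induction I)
  case (Cons h I)
  then show ?case
    using exhaust_2[of h] by (auto simp: sum.lessThan_Suc_shift algebra_simps simp del: sum.lessThan_Suc)
qed simp

lemma prod_nth_2:
  fixes G :: "2 \<Rightarrow> 'a :: comm_semiring_1"
  shows "(\<Prod>m<length I. G (I ! m)) = G 1 ^ count_list I 1 * G 2 ^ count_list I 2"
proof (induction I)
  case (Cons h I)
  then show ?case
    using exhaust_2[of h] by (auto simp: prod.lessThan_Suc_shift algebra_simps simp del: prod.lessThan_Suc)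
qed simp

text \<open>The sum of \<open>G (I ! \<pi> m)\<close> over all \<open>\<pi>\<close> does not depend on \<open>m\<close>, so it may be averaged over \<open>m\<close>.\<close>

lemma symmetrize_head:
  assumes I: "I \<noteq> []"
    and S: "\<And>\<pi>. \<pi> permutes {..<length I} \<Longrightarrow> S (permute_list \<pi> I) = G (I ! \<pi> 0)"
  shows "symmetrize S I = (\<Sum>m<length I. G (I ! m)) / length I"
proof -
  let ?N = "length I" and ?P = "{\<pi>. \<pi> permutes {..<length I}}"
  have N: "?N > 0" using I by simp
  have shift: "(\<Sum>\<pi>\<in>?P. G (I ! \<pi> m)) = (\<Sum>\<pi>\<in>?P. G (I ! \<pi> 0))" if "m < ?N" for m
  proof -
    have \<tau>: "Transposition.transpose 0 m permutes {..<?N}"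
      using that N by (intro permutes_swap_id) auto
    \<comment> \<open>Composition with the transposition permutes the set of permutations and moves
      position 0 to m.\<close>
    have "(\<Sum>\<pi>\<in>?P. G (I ! \<pi> 0)) = (\<Sum>\<pi>\<in>?P. G (I ! (\<pi> \<circ> Transposition.transpose 0 m) 0))"
      using sum_permutations_compose_right[OF \<tau>, of "\<lambda>\<pi>. G (I ! \<pi> 0)"] by simp
    then show ?thesis by simp
  qed
  have "real ?N * (\<Sum>\<pi>\<in>?P. G (I ! \<pi> 0)) = (\<Sum>m<?N. \<Sum>\<pi>\<in>?P. G (I ! \<pi> m))"
    using shift by simp
  also have "\<dots> = (\<Sum>\<pi>\<in>?P. \<Sum>m<?N. G (I ! \<pi> m))"
    by (rule sum.swap)
  also have "\<dots> = (\<Sum>\<pi>\<in>?P. \<Sum>m<?N. G (I ! m))"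
  proof (rule sum.cong[OF refl])
    fix \<pi> assume "\<pi> \<in> ?P"
    then have "bij_betw \<pi> {..<?N} {..<?N}" by (auto intro: permutes_imp_bij)
    then show "(\<Sum>m<?N. G (I ! \<pi> m)) = (\<Sum>m<?N. G (I ! m))"
      by (rule sum.reindex_bij_betw)
  qed
  also have "\<dots> = fact ?N * (\<Sum>m<?N. G (I ! m))"
    using card_permutations[OF refl, of "{..<?N}"] by simp
  finally have "(\<Sum>\<pi>\<in>?P. G (I ! \<pi> 0)) / fact ?N = (\<Sum>m<?N. G (I ! m)) / ?N"
    using N by (simp add: field_simps)
  then show ?thesis
    unfolding symmetrize_def using S by simp
qed

text \<open>The metric is constant, so only the term differentiating \<open>K\<close> survives; it
  is diagonal, so the contraction depends on the leading index alone and
  \<open>symmetrize_head\<close> applies. The relative minus sign comes from the metric entry at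
  [2, 2].\<close>

lemma schouten_mink_metric:
  assumes K: "\<And>w J. length J = n \<Longrightarrow> K w J = k (count_list J 1) (count_list J 2) w"
    and I: "length I = Suc n"
  shows "schouten n 2 K mink_metric z I = - 2 / real (Suc n) *
    (real (count_list I 1) * partial_d 1 (k (count_list I 1 - 1) (count_list I 2)) z
     - real (count_list I 2) * partial_d 2 (k (count_list I 1) (count_list I 2 - 1)) z)"
proof -
  let ?p = "count_list I 1" and ?q = "count_list I 2"
  \<comment> \<open>\<open>G h\<close> is the contracted term when \<open>h\<close> leads: the other
    n indices contain one \<open>h\<close> fewer than \<open>I\<close>.\<close>
  define G where "G h = (if h = (1 :: 2) then partial_d 1 (k (?p - 1) ?q) z
      else - partial_d 2 (k ?p (?q - 1)) z)" for h
  let ?S = "\<lambda>I. \<Sum>k\<in>UNIV. mink_metric z (k # take 1 I) * partial_d k (\<lambda>w. K w (drop 1 I)) z"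
  have S: "?S (permute_list \<pi> I) = G (I ! \<pi> 0)" if \<pi>: "\<pi> permutes {..<length I}" for \<pi>
  proof -
    obtain h J where J: "permute_list \<pi> I = h # J"
      using I length_permute_list[of \<pi> I] by (cases "permute_list \<pi> I") auto
    have h: "h = I ! \<pi> 0"
      using permute_list_nth[OF \<pi>, of 0] I by (simp add: J)
    have len: "length J = n"
      using length_permute_list[of \<pi> I] I by (simp add: J)
    have m: "mset (h # J) = mset I"
      unfolding J[symmetric] using \<pi> by (rule mset_permute_list)
    consider "h = 1" | "h = 2" using exhaust_2 by blast
    then show ?thesis
    proof cases
      case 1
      then have "count_list J 1 = ?p - 1" "count_list J 2 = ?q"
        using m unfolding mset_2_eq_iff by auto
      then show ?thesis
        using 1 by (simp add: J UNIV_2 mink_metric_def G_def K[OF len] flip: h)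
    next
      case 2
      then have "count_list J 1 = ?p" "count_list J 2 = ?q - 1"
        using m unfolding mset_2_eq_iff by auto
      then show ?thesis
        using 2 by (simp add: J UNIV_2 mink_metric_def G_def K[OF len] flip: h)
    qed
  qed
  have "symmetrize ?S I = (\<Sum>m<length I. G (I ! m)) / length I"
    using I by (intro symmetrize_head S) auto
  then have 1: "symmetrize ?S I = (real ?p * partial_d 1 (k (?p - 1) ?q) z
      - real ?q * partial_d 2 (k ?p (?q - 1)) z) / real (Suc n)"
    unfolding sum_nth_2 by (simp add: G_def I)
  have 2: "symmetrize (\<lambda>I. \<Sum>k\<in>UNIV.
          K z (k # take (n - 1) I) * partial_d k (\<lambda>w. mink_metric w (drop (n - 1) I)) z) I = 0"
    by (simp add: mink_metric_def symmetrize_def)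
  show ?thesis
    unfolding schouten_def 2 using 1 I by (simp add: field_simps)
qed

section \<open>The bijection between parameters and Killing tensors\<close>

lemma killing_tensor_eq_comp:
  "killing_tensor n c z I =
    (if length I = n then killing_comp c (count_list I 1) (count_list I 2) z else 0)"
  by (simp add: killing_tensor_def killing_comp_def Let_def)

lemma killing_tensor_in_killing_tensors: "killing_tensor n c \<in> killing_tensors n"
proof -
  have smooth: "smooth_fn (\<lambda>z. killing_tensor n c z I)" for I
  proof (cases "length I = n")
    case True
    then show ?thesis
      using smooth_fn_killing_comp[of c "count_list I 1" "count_list I 2"]
      by (simp add: killing_tensor_eq_comp)
  next
    case False
    then show ?thesis
      using smooth_fn_cmult[OF smooth_fn_killing_comp, of 0] by (simp add: killing_tensor_eq_comp)
  qed
  have perm: "killing_tensor n c z I = killing_tensor n c z J" if "mset I = mset J" for z I J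
    using mset_eq_length[OF that] that unfolding mset_2_eq_iff by (simp add: killing_tensor_eq_comp)
  have "symmetric_tensor_field n (killing_tensor n c)"
    unfolding symmetric_tensor_field_def
    by (intro conjI allI impI smooth perm) (simp_all add: killing_tensor_eq_comp)
  moreover have "schouten n 2 (killing_tensor n c) mink_metric z I = 0" for z I
  proof (cases "length I = Suc n")
    case True
    show ?thesis
      by (subst schouten_mink_metric[OF _ True, of _ "killing_comp c"])
        (simp_all add: killing_tensor_eq_comp partial_d_killing_comp)
  qed (simp add: schouten_def)
  ultimately show ?thesis
    by (simp add: killing_tensors_def fun_eq_iff)
qed

lemma killing_tensor_surj:
  assumes "K \<in> killing_tensors n"
  shows "K \<in> killing_tensor n ` param_space n"
proof -
  \<comment> \<open>A canonical multi-index for each pair of counts; by symmetry these components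
    determine \<open>K\<close>.\<close>
  define I where "I p q = replicate p (1 :: 2) @ replicate q 2" for p q
  have cI: "count_list (I p q) 1 = p" "count_list (I p q) 2 = q" for p q
    by (simp_all add: I_def count_list_replicate)
  have lI: "length (I p q) = p + q" for p q by (simp add: I_def)
  define k where "k p q z = K z (I p q)" for p q z
  have sym: "symmetric_tensor_field n K" and br: "schouten n 2 K mink_metric z J = 0" for z J
    using assms by (auto simp: killing_tensors_def fun_eq_iff)
  have K: "K z J = k (count_list J 1) (count_list J 2) z" for z J
  proof -
    have "mset J = mset (I (count_list J 1) (count_list J 2))"
      by (simp add: mset_2_eq_iff cI)
    then show ?thesis using sym unfolding symmetric_tensor_field_def k_def by blast
  qed
  have smooth: "smooth_fn (k p q)" for p q
    using sym unfolding symmetric_tensor_field_def k_def[abs_def] by blast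
  have "real p * partial_d 1 (k (p - 1) q) z = real q * partial_d 2 (k p (q - 1)) z"
    if "p + q = Suc n" for p q z
    using schouten_mink_metric[of n K k "I p q" z, OF K] br[of z "I p q"] that by (simp add: cI lI)
  from killing_equations_solution[OF smooth this]
  obtain c where c: "c \<in> param_space n" "\<And>p q. p + q = n \<Longrightarrow> k p q = killing_comp c p q"
    by blast
  have "K z J = killing_tensor n c z J" for z J
  proof (cases "length J = n")
    case True
    then show ?thesis using c(2) count_list_1_2[of J] by (simp add: killing_tensor_eq_comp K[of z J])
  next
    case False
    then show ?thesis using sym by (simp add: killing_tensor_eq_comp symmetric_tensor_field_def)
  qed
  then show ?thesis using c(1) by (intro image_eqI[of _ _ c]) auto
qed

text \<open>By linearity the difference of the two families has zero components, hence is zero up to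
  degree n; beyond that both families vanish by convention.\<close>

lemma killing_tensor_inj: "inj_on (killing_tensor n) (param_space n)"
proof (rule inj_onI, intro ext)
  fix c d i j
  assume cd: "c \<in> param_space n" "d \<in> param_space n" and eq: "killing_tensor n c = killing_tensor n d"
  have "killing_comp (\<lambda>i j. c i j - d i j) p q = (\<lambda>z. 0)" if "p + q = n" for p q
  proof
    fix z
    have "killing_tensor n c z (replicate p 1 @ replicate q 2)
        = killing_tensor n d z (replicate p 1 @ replicate q 2)"
      by (simp add: eq)
    then show "killing_comp (\<lambda>i j. c i j - d i j) p q z = 0"
      using that by (simp add: killing_tensor_eq_comp count_list_replicate killing_comp_diff)
  qed
  then show "c i j = d i j"
    using killing_comp_eq_0_imp[of n "\<lambda>i j. c i j - d i j" i j] cd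
    by (cases "i + j \<le> n") (auto simp: param_space_def)
qed

lemma bij_betw_killing_tensor:
  "bij_betw (killing_tensor n) (param_space n) (killing_tensors n)"
  unfolding bij_betw_def
  using killing_tensor_inj killing_tensor_in_killing_tensors killing_tensor_surj by blast

lemma killing_params_killing_tensor:
  "c \<in> param_space n \<Longrightarrow> killing_params n (killing_tensor n c) = c"
  unfolding killing_params_def by (rule inv_into_f_f[OF killing_tensor_inj])

section \<open>Killing vectors as the case of valence 1\<close>

lemma vector_tensor_eq_killing_tensor:
  assumes "\<And>z. Y z $ 1 = c 0 0 * z $ 2 + c 1 0" "\<And>z. Y z $ 2 = c 0 0 * z $ 1 + c 0 1"
  shows "vector_tensor Y = killing_tensor 1 c"
proof (intro ext)
  fix z and I :: "2 list"
  consider "length I \<noteq> 1" | "I = [1]" | "I = [2]"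
    by (cases I rule: list.exhaust; cases "tl I"; use exhaust_2 in auto)
  then show "vector_tensor Y z I = killing_tensor 1 c z I"
    by cases (simp_all add: vector_tensor_def killing_tensor_eq_comp killing_comp_def assms)
qed

lemma killing_vector_basis_T_X_H: "killing_vector_basis vf_T vf_X vf_H"
proof -
  have "killing_vector Y" if "vector_tensor Y = killing_tensor 1 c" for Y c
    using killing_tensor_in_killing_tensors[of 1 c] that by (simp add: killing_vector_def)
  note kv = this[OF vector_tensor_eq_killing_tensor]
  \<comment> \<open>The components of valence 1 are \<open>c 0 0 * x + c 1 0\<close> and
    \<open>c 0 0 * t + c 0 1\<close>, so T, X and H have a single unit parameter at (1, 0), (0, 1)
    and (0, 0).\<close>
  have "killing_vector vf_T"
    by (rule kv[of _ "coord_field 1 0"]) (simp_all add: vf_T_def coord_field_def)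
  moreover have "killing_vector vf_X"
    by (rule kv[of _ "coord_field 0 1"]) (simp_all add: vf_X_def coord_field_def)
  moreover have "killing_vector vf_H"
    by (rule kv[of _ "coord_field 0 0"]) (simp_all add: vf_H_def coord_field_def)
  moreover have "\<exists>!(a, b, d). Y = (\<lambda>z. a *\<^sub>R vf_T z + b *\<^sub>R vf_X z + d *\<^sub>R vf_H z)"
    if Y: "killing_vector Y" for Y
  proof -
    obtain c where c: "vector_tensor Y = killing_tensor 1 c"
      using killing_tensor_surj[of "vector_tensor Y" 1] Y unfolding killing_vector_def by blast
    have Y1: "Y z $ 1 = c 0 0 * z $ 2 + c 1 0" and Y2: "Y z $ 2 = c 0 0 * z $ 1 + c 0 1" for z
      using fun_cong[OF fun_cong[OF c], of z "[1]"] fun_cong[OF fun_cong[OF c], of z "[2]"]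
      by (simp_all add: vector_tensor_def killing_tensor_eq_comp killing_comp_def)
    have "Y = (\<lambda>z. a *\<^sub>R vf_T z + b *\<^sub>R vf_X z + d *\<^sub>R vf_H z) \<longleftrightarrow> (a, b, d) = (c 1 0, c 0 1, c 0 0)"
      (is "?L \<longleftrightarrow> ?R") for a b d
    proof
      assume L: ?L
      have "Y z $ 1 = a + d * z $ 2" "Y z $ 2 = b + d * z $ 1" for z
        by (simp_all add: L vf_T_def vf_X_def vf_H_def)
      \<comment> \<open>The origin yields a and b; the point (1, 1) then yields d.\<close>
      from this[of 0] this[of "vector [1, 1]"] show ?R
        by (simp add: Y1 Y2)
    qed (simp add: fun_eq_iff vec_eq_iff forall_2 Y1 Y2 vf_T_def vf_X_def vf_H_def)
    then show ?thesis
      by (intro ex1I[of _ "(c 1 0, c 0 1, c 0 0)"]) auto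
  qed
  ultimately show ?thesis
    unfolding killing_vector_basis_def by blast
qed

section \<open>Umbral form of the action\<close>

abbreviation cst :: "real \<Rightarrow> real poly poly" where "cst r \<equiv> [:[:r:]:]"
abbreviation \<alpha> :: "real poly poly" where "\<alpha> \<equiv> [:0, 1:]"
abbreviation \<beta> :: "real poly poly" where "\<beta> \<equiv> [:[:0, 1:]:]"

text \<open>Cutting the exponents at n loses nothing for \<open>c\<close> in
  \<open>param_space n\<close> and leaves a finite linear combination of coefficients, which is
  additive on all polynomials and easy to differentiate.\<close>

definition umbral :: "nat \<Rightarrow> (nat \<Rightarrow> nat \<Rightarrow> real) \<Rightarrow> real poly poly \<Rightarrow> real" where
  "umbral n c P = (\<Sum>k\<le>n. \<Sum>l\<le>n. c k l * coeff (coeff P k) l)"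

lemma umbral_add: "umbral n c (P + Q) = umbral n c P + umbral n c Q"
  by (simp add: umbral_def algebra_simps sum.distrib)

lemma umbral_diff: "umbral n c (P - Q) = umbral n c P - umbral n c Q"
  by (simp add: umbral_def algebra_simps sum_subtractf)

lemma umbral_cst: "umbral n c (cst r * P) = r * umbral n c P"
  by (simp add: umbral_def sum_distrib_left mult_ac)

lemma umbral_0 [simp]: "umbral n c 0 = 0"
  by (simp add: umbral_def)

lemma umbral_sum: "umbral n c (sum f S) = (\<Sum>s\<in>S. umbral n c (f s))"
  by (induction S rule: infinite_finite_induct) (simp_all add: umbral_add)

lemma coeff_monomial_alpha_beta: "coeff (coeff (\<alpha> ^ i * \<beta> ^ j) k) l = (if k = i \<and> l = j then 1 else 0)"
proof -
  have "\<beta> ^ j = [:monom 1 j:]"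
    by (induction j) (simp_all add: monom_Suc one_pCons monom_0)
  moreover have "\<alpha> ^ i = monom 1 i"
    by (induction i) (simp_all add: monom_Suc monom_0)
  ultimately show ?thesis
    by simp
qed

lemma umbral_monomial:
  assumes "c \<in> param_space n"
  shows "umbral n c (\<alpha> ^ i * \<beta> ^ j) = c i j"
proof -
  have "umbral n c (\<alpha> ^ i * \<beta> ^ j) = (\<Sum>k\<le>n. if k = i then if j \<le> n then c i j else 0 else 0)"
    unfolding umbral_def coeff_monomial_alpha_beta
    by (intro sum.cong refl) (auto simp: if_distrib[of "\<lambda>x. _ * x"] cong: if_cong)
  also have "\<dots> = c i j"
    using assms by (auto simp: param_space_def)
  finally show ?thesis .
qed

lemma cst_power: "cst r ^ m = cst (r ^ m)"
  by (induction m) (simp_all add: one_pCons)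

lemma cst_of_nat: "of_nat m = cst (real m)"
  by (simp add: of_nat_poly)

lemma cst_prod: "(\<Prod>s\<in>S. cst (f s)) = cst (\<Prod>s\<in>S. f s)"
  by (induction S rule: infinite_finite_induct) (simp_all add: one_pCons)

text \<open>The scalars are those in \<open>killing_comp\<close>, so the functional applied termwise
  recovers components.\<close>

lemma binomial_product_expand:
  "(A + cst x) ^ p * (B + cst t) ^ q = (\<Sum>i\<le>p. \<Sum>j\<le>q.
     cst (real (p choose i) * real (q choose j) * x ^ (p - i) * t ^ (q - j)) * (A ^ i * B ^ j))"
  unfolding binomial_ring sum_product cst_of_nat cst_power
  by (intro sum.cong refl) (simp add: algebra_simps)

text \<open>The polynomials \<open>A\<close> and \<open>B\<close> will be affine, so even for i + j
  > n the product \<open>A ^ i * B ^ j\<close> can have terms of low degree; the explicit cut-off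
  keeps the result in \<open>param_space n\<close>.\<close>

definition umbral_action ::
  "nat \<Rightarrow> (nat \<Rightarrow> nat \<Rightarrow> real) \<Rightarrow> real poly poly \<Rightarrow> real poly poly \<Rightarrow> nat \<Rightarrow> nat \<Rightarrow> real" where
  "umbral_action n c A B i j = (if i + j \<le> n then umbral n c (A ^ i * B ^ j) else 0)"

lemma umbral_action_in_param_space: "umbral_action n c A B \<in> param_space n"
  by (simp add: umbral_action_def param_space_def)

text \<open>Since i \<le> p and j \<le> q give i + j \<le> n, the cut-off in
  \<open>umbral_action\<close> never intervenes.\<close>

lemma killing_comp_umbral_action:
  assumes "p + q = n"
  shows "killing_comp (umbral_action n c A B) p q z = umbral n c ((A + cst (z $ 2)) ^ p * (B + cst (z $ 1)) ^ q)"
  unfolding killing_comp_def binomial_product_expand umbral_sum umbral_cst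
  using assms by (intro sum.cong refl) (simp add: umbral_action_def mult_ac)

lemma killing_comp_umbral:
  assumes "c \<in> param_space n"
  shows "killing_comp c p q z = umbral n c ((\<alpha> + cst (z $ 2)) ^ p * (\<beta> + cst (z $ 1)) ^ q)"
  unfolding killing_comp_def binomial_product_expand umbral_sum umbral_cst umbral_monomial[OF assms]
  by (simp add: mult_ac)

section \<open>Push-forward of Killing tensors by isometries\<close>

lemma sum_prod_lists:
  fixes F :: "'b \<Rightarrow> 'a :: finite \<Rightarrow> 'c :: comm_semiring_1"
  shows "(\<Sum>J | length J = length I. \<Prod>r<length I. F (I ! r) (J ! r)) =
    (\<Prod>r<length I. \<Sum>k\<in>UNIV. F (I ! r) k)"
proof (induction I)
  case (Cons h I)
  have *: "{J :: 'a list. length J = Suc m} = (\<lambda>(k, J). k # J) ` (UNIV \<times> {J. length J = m})" for m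
    by (auto simp: length_Suc_conv)
  have inj: "inj_on (\<lambda>(k, J). k # J) (UNIV \<times> {J :: 'a list. length J = m})" for m
    by (auto simp: inj_on_def)
  have "(\<Sum>J | length J = length (h # I). \<Prod>r<length (h # I). F ((h # I) ! r) (J ! r)) =
      (\<Sum>(k, J)\<in>UNIV \<times> {J. length J = length I}. F h k * (\<Prod>r<length I. F (I ! r) (J ! r)))"
    by (subst (1) length_Cons, subst *, subst sum.reindex[OF inj])
      (simp add: prod.lessThan_Suc_shift case_prod_unfold del: prod.lessThan_Suc)
  also have "\<dots> = (\<Sum>k\<in>UNIV. F h k) * (\<Sum>J | length J = length I. \<Prod>r<length I. F (I ! r) (J ! r))"
    by (simp add: sum.cartesian_product[symmetric] sum_product)
  finally show ?case
    by (simp add: Cons.IH prod.lessThan_Suc_shift del: prod.lessThan_Suc)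
qed simp

text \<open>\<open>inv\<close> is a right inverse because the map is onto; the preimage
  \<open>u\<close> undoes the translation and then applies the opposite boost.\<close>

lemma mink_isom_inv: "mink_isom \<phi> a b (inv (mink_isom \<phi> a b) z) = z"
proof -
  define t x where "t = z $ 1 - a" and "x = z $ 2 - b"
  define u where "u = (vector [t * cosh \<phi> - x * sinh \<phi>, x * cosh \<phi> - t * sinh \<phi>] :: plane)"
  have "u $ 1 * cosh \<phi> + u $ 2 * sinh \<phi> = t * (cosh \<phi> ^ 2 - sinh \<phi> ^ 2)"
    "u $ 1 * sinh \<phi> + u $ 2 * cosh \<phi> = x * (cosh \<phi> ^ 2 - sinh \<phi> ^ 2)"
    by (simp_all add: u_def algebra_simps power2_eq_square)
  then have "mink_isom \<phi> a b u = z"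
    by (simp add: mink_isom_def vec_eq_iff forall_2 hyperbolic_pythagoras t_def x_def)
  then have "z \<in> range (mink_isom \<phi> a b)" by (metis rangeI)
  then show ?thesis by (rule f_inv_into_f)
qed

lemma partial_d_affine:
  "partial_d k (\<lambda>w. w $ 1 * r + w $ 2 * s + d) z = (if k = 1 then r else s)"
proof -
  have "((\<lambda>w. w $ 1 * r + w $ 2 * s + d) has_derivative (\<lambda>v. v $ 1 * r + v $ 2 * s)) (at z)"
    by (auto intro!: derivative_eq_intros bounded_linear_imp_has_derivative bounded_linear_vec_nth)
  then show ?thesis
    using exhaust_2[of k] by (auto simp: partial_d_eqI axis_def)
qed

text \<open>The Jacobian is constant, and each component at the preimage \<open>u\<close> is the
  functional applied to a product of shifted variables. The sum over multi-indices therefore factors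
  into linear forms, and \<open>z = f u\<close> turns the shifts by \<open>u\<close> into shifts by
  \<open>z\<close>, leaving -b and -a behind.\<close>

lemma pushforward_killing_tensor:
  assumes c: "c \<in> param_space n"
  shows "pushforward (mink_isom \<phi> a b) (killing_tensor n c) = killing_tensor n
    (umbral_action n c (cst (cosh \<phi>) * \<alpha> + cst (sinh \<phi>) * \<beta> - cst b)
      (cst (sinh \<phi>) * \<alpha> + cst (cosh \<phi>) * \<beta> - cst a))"
    (is "_ = killing_tensor n (umbral_action n c ?A ?B)")
proof (intro ext)
  fix z :: plane and I :: "2 list"
  let ?f = "mink_isom \<phi> a b"
  define u where "u = inv ?f z"
  have z: "z $ 1 = u $ 1 * cosh \<phi> + u $ 2 * sinh \<phi> + a" "z $ 2 = u $ 1 * sinh \<phi> + u $ 2 * cosh \<phi> + b"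
    using mink_isom_inv[of \<phi> a b z] unfolding u_def[symmetric] by (auto simp: mink_isom_def)
  show "pushforward ?f (killing_tensor n c) z I = killing_tensor n (umbral_action n c ?A ?B) z I"
  proof (cases "length I = n")
    case False
    then show ?thesis by (simp add: pushforward_def killing_tensor_eq_comp)
  next
    case I: True
    define M where "M i k = (if i = k then cosh \<phi> else sinh \<phi>)" for i k :: 2
    \<comment> \<open>Index 1 pairs \<open>\<alpha>\<close> with x and index 2 pairs
      \<open>\<beta>\<close> with t, following \<open>killing_comp_umbral\<close>.\<close>
    define Y where "Y k = (if k = 1 then \<alpha> + cst (u $ 2) else \<beta> + cst (u $ 1))" for k :: 2
    have M: "partial_d k (\<lambda>w. ?f w $ i) u = M i k" for i k
      using exhaust_2[of i] exhaust_2[of k] by (auto simp: mink_isom_def partial_d_affine M_def)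
    have K: "killing_tensor n c u J = umbral n c (\<Prod>r<n. Y (J ! r))" if "length J = n" for J
      using prod_nth_2[of Y J] that
      by (simp add: killing_tensor_eq_comp killing_comp_umbral[OF c] Y_def)
    have "pushforward ?f (killing_tensor n c) z I =
        (\<Sum>J | length J = n. (\<Prod>r<n. M (I ! r) (J ! r)) * umbral n c (\<Prod>r<n. Y (J ! r)))"
      unfolding pushforward_def u_def[symmetric] M I by (intro sum.cong refl) (simp add: K)
    also have "\<dots> = umbral n c (\<Sum>J | length J = n. \<Prod>r<n. cst (M (I ! r) (J ! r)) * Y (J ! r))"
      unfolding umbral_sum prod.distrib cst_prod umbral_cst ..
    \<comment> \<open>Distributivity exchanges the sum over lists with the product over
      positions.\<close>
    also have "\<dots> = umbral n c (\<Prod>r<n. \<Sum>k\<in>UNIV. cst (M (I ! r) k) * Y k)"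
      using sum_prod_lists[of "\<lambda>i k. cst (M i k) * Y k" I] I by simp
    also have "(\<Prod>r<n. \<Sum>k\<in>UNIV. cst (M (I ! r) k) * Y k) =
        (?A + cst (z $ 2)) ^ count_list I 1 * (?B + cst (z $ 1)) ^ count_list I 2"
    proof -
      have "(\<Sum>k\<in>UNIV. cst (M 1 k) * Y k) = ?A + cst (z $ 2)"
        "(\<Sum>k\<in>UNIV. cst (M 2 k) * Y k) = ?B + cst (z $ 1)"
        by (simp_all add: UNIV_2 M_def Y_def z algebra_simps)
      then show ?thesis
        using prod_nth_2[of "\<lambda>i. \<Sum>k\<in>UNIV. cst (M i k) * Y k" I] I by simp
    qed
    also have "umbral n c \<dots> = killing_tensor n (umbral_action n c ?A ?B) z I"
      using I count_list_1_2[of I] by (simp add: killing_tensor_eq_comp killing_comp_umbral_action)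
    finally show ?thesis .
  qed
qed

section \<open>Infinitesimal generators\<close>

text \<open>Derivatives are taken coefficient by coefficient because \<open>umbral\<close> reads
  only finitely many coefficients.\<close>

definition has_coeff_derivative ::
  "(real \<Rightarrow> real poly poly) \<Rightarrow> real poly poly \<Rightarrow> real \<Rightarrow> bool" where
  "has_coeff_derivative P P' s \<longleftrightarrow> (\<forall>k l.
     ((\<lambda>s. coeff (coeff (P s) k) l) has_real_derivative coeff (coeff P' k) l) (at s))"

lemma has_coeff_derivative_const: "has_coeff_derivative (\<lambda>s. P) 0 s"
  by (simp add: has_coeff_derivative_def)

lemma has_coeff_derivative_cst:
  assumes "(f has_real_derivative f') (at s)"
  shows "has_coeff_derivative (\<lambda>s. cst (f s)) (cst f') s"
  using assms by (auto simp: has_coeff_derivative_def coeff_pCons split: nat.split)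

lemma has_coeff_derivative_add:
  "has_coeff_derivative P P' s \<Longrightarrow> has_coeff_derivative Q Q' s \<Longrightarrow>
    has_coeff_derivative (\<lambda>s. P s + Q s) (P' + Q') s"
  by (simp add: has_coeff_derivative_def DERIV_add)

lemma has_coeff_derivative_diff:
  "has_coeff_derivative P P' s \<Longrightarrow> has_coeff_derivative Q Q' s \<Longrightarrow>
    has_coeff_derivative (\<lambda>s. P s - Q s) (P' - Q') s"
  by (simp add: has_coeff_derivative_def DERIV_diff)

lemma has_coeff_derivative_mult:
  assumes "has_coeff_derivative P P' s" "has_coeff_derivative Q Q' s"
  shows "has_coeff_derivative (\<lambda>s. P s * Q s) (P' * Q s + P s * Q') s"
  unfolding has_coeff_derivative_def
proof (intro allI)
  fix k l
  have "((\<lambda>s. \<Sum>i\<le>k. \<Sum>j\<le>l. coeff (coeff (P s) i) j * coeff (coeff (Q s) (k - i)) (l - j))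
      has_real_derivative (\<Sum>i\<le>k. \<Sum>j\<le>l.
        coeff (coeff (P s) i) j * coeff (coeff Q' (k - i)) (l - j) +
        coeff (coeff P' i) j * coeff (coeff (Q s) (k - i)) (l - j))) (at s)"
    using assms unfolding has_coeff_derivative_def by (intro DERIV_sum DERIV_mult') auto
  then show "((\<lambda>s. coeff (coeff (P s * Q s) k) l) has_real_derivative
      coeff (coeff (P' * Q s + P s * Q') k) l) (at s)"
    by (simp add: coeff_mult coeff_sum sum.distrib add.commute)
qed

lemma has_coeff_derivative_power:
  assumes "has_coeff_derivative P P' s"
  shows "has_coeff_derivative (\<lambda>s. P s ^ m) (cst (real m) * P s ^ (m - 1) * P') s"
proof (induction m)
  case 0
  show ?case using has_coeff_derivative_const[of 1 s] by simp
next
  case (Suc m)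
  have "P' * P s ^ m + P s * (cst (real m) * P s ^ (m - 1) * P') = cst (real (Suc m)) * P s ^ m * P'"
  proof (cases m)
    case (Suc m')
    have "cst (real (Suc m)) = 1 + cst (real m)"
      by (simp add: one_pCons)
    then show ?thesis by (simp only: Suc diff_Suc_1 power_Suc) (simp only: algebra_simps)
  qed (simp add: one_pCons)
  then show ?case
    using has_coeff_derivative_mult[OF assms Suc] by simp
qed

lemma has_coeff_derivative_umbral:
  assumes "has_coeff_derivative P P' s"
  shows "((\<lambda>s. umbral n c (P s)) has_real_derivative umbral n c P') (at s)"
  using assms unfolding umbral_def has_coeff_derivative_def
  by (intro DERIV_sum DERIV_cmult) auto

lemmas has_coeff_derivative_intros =
  has_coeff_derivative_const has_coeff_derivative_cst has_coeff_derivative_add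
  has_coeff_derivative_diff has_coeff_derivative_mult has_coeff_derivative_power

text \<open>The combination w H + a T + b X treats all three Killing vectors in one
  computation.\<close>

definition killing_field :: "real \<Rightarrow> real \<Rightarrow> real \<Rightarrow> plane \<Rightarrow> plane" where
  "killing_field w a b z = vector [w * z $ 2 + a, w * z $ 1 + b]"

text \<open>On \<open>param_space n\<close> this will be a V_1 + b V_2 + w V_3. The cut-off matters
  for i + j = n + 1, where the formula would still see parameters of degree n.\<close>

definition generator ::
  "nat \<Rightarrow> real \<Rightarrow> real \<Rightarrow> real \<Rightarrow> (nat \<Rightarrow> nat \<Rightarrow> real) \<Rightarrow> nat \<Rightarrow> nat \<Rightarrow> real" where
  "generator n w a b c i j = (if i + j \<le> n then
     real i * (b * c (i - 1) j - w * c (i - 1) (j + 1)) +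
     real j * (a * c i (j - 1) - w * c (i + 1) (j - 1)) else 0)"

lemma generator_in_param_space: "generator n w a b c \<in> param_space n"
  by (simp add: generator_def param_space_def)

text \<open>\<open>A s\<close> and \<open>B s\<close> belong to the isometry with parameters
  \<open>s * w\<close>, \<open>s * a\<close>, \<open>s * b\<close>. The shifts allow two uses: x = t
  = 0 for the parameters, the coordinates of a point for the components.\<close>

lemma umbral_power_derivative:
  fixes w a b :: real
  defines "A \<equiv> \<lambda>s. cst (cosh (s * w)) * \<alpha> + cst (sinh (s * w)) * \<beta> - cst (s * b)"
    and "B \<equiv> \<lambda>s. cst (sinh (s * w)) * \<alpha> + cst (cosh (s * w)) * \<beta> - cst (s * a)"
  shows "((\<lambda>s. umbral n c ((A s + cst x) ^ p * (B s + cst t) ^ q)) has_real_derivative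
    umbral n c (cst (real p) * (\<alpha> + cst x) ^ (p - 1) * (cst w * \<beta> - cst b) * (\<beta> + cst t) ^ q +
      (\<alpha> + cst x) ^ p * (cst (real q) * (\<beta> + cst t) ^ (q - 1) * (cst w * \<alpha> - cst a)))) (at 0)"
proof -
  have 0: "A 0 = \<alpha>" "B 0 = \<beta>"
    by (simp_all add: A_def B_def)
  have lin: "((\<lambda>s. s * r) has_real_derivative r) (at 0)" for r
    by (auto intro!: derivative_eq_intros)
  have hyp: "((\<lambda>s. cosh (s * w)) has_real_derivative 0) (at 0)"
    "((\<lambda>s. sinh (s * w)) has_real_derivative w) (at 0)"
    by (auto intro!: derivative_eq_intros)
  \<comment> \<open>The derivative is stated in the unreduced shape that the sum and product rules
    produce.\<close>
  have "has_coeff_derivative (\<lambda>s. A s + cst x)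
      (cst 0 * \<alpha> + cst (cosh (0 * w)) * 0 + (cst w * \<beta> + cst (sinh (0 * w)) * 0) - cst b + 0) 0"
    unfolding A_def by (intro has_coeff_derivative_intros hyp lin)
  then have A: "has_coeff_derivative (\<lambda>s. A s + cst x) (cst w * \<beta> - cst b) 0"
    by simp
  have "has_coeff_derivative (\<lambda>s. B s + cst t)
      (cst w * \<alpha> + cst (sinh (0 * w)) * 0 + (cst 0 * \<beta> + cst (cosh (0 * w)) * 0) - cst a + 0) 0"
    unfolding B_def by (intro has_coeff_derivative_intros hyp lin)
  then have B: "has_coeff_derivative (\<lambda>s. B s + cst t) (cst w * \<alpha> - cst a) 0"
    by simp
  show ?thesis
    using has_coeff_derivative_umbral[OF has_coeff_derivative_mult
        [OF has_coeff_derivative_power[OF A] has_coeff_derivative_power[OF B]], of n c p q]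
    unfolding 0 .
qed

context
  fixes n :: nat and c :: "nat \<Rightarrow> nat \<Rightarrow> real"
  assumes c: "c \<in> param_space n"
begin

lemma umbral_action_derivative:
  "((\<lambda>s. umbral_action n c
      (cst (cosh (s * w)) * \<alpha> + cst (sinh (s * w)) * \<beta> - cst (s * b))
      (cst (sinh (s * w)) * \<alpha> + cst (cosh (s * w)) * \<beta> - cst (s * a)) i j)
    has_real_derivative - generator n w a b c i j) (at 0)"
proof (cases "i + j \<le> n")
  case True
  \<comment> \<open>Regrouping into monomials lets \<open>umbral_monomial\<close> read off each one
    as a parameter.\<close>
  have "cst (real i) * \<alpha> ^ (i - 1) * (cst w * \<beta> - cst b) * \<beta> ^ j +
      \<alpha> ^ i * (cst (real j) * \<beta> ^ (j - 1) * (cst w * \<alpha> - cst a)) =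
    cst (real i) * (cst w * (\<alpha> ^ (i - 1) * \<beta> ^ (j + 1)) - cst b * (\<alpha> ^ (i - 1) * \<beta> ^ j)) +
    cst (real j) * (cst w * (\<alpha> ^ (i + 1) * \<beta> ^ (j - 1)) - cst a * (\<alpha> ^ i * \<beta> ^ (j - 1)))"
    unfolding power_add power_one_right by (simp only: algebra_simps)
  then have "umbral n c (cst (real i) * \<alpha> ^ (i - 1) * (cst w * \<beta> - cst b) * \<beta> ^ j +
      \<alpha> ^ i * (cst (real j) * \<beta> ^ (j - 1) * (cst w * \<alpha> - cst a))) = - generator n w a b c i j"
    by (simp only: generator_def True if_True umbral_add umbral_diff umbral_cst umbral_monomial[OF c])
      (simp only: algebra_simps minus_add_distrib minus_diff_eq minus_minus)
  then show ?thesis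
    using umbral_power_derivative[of n c w b 0 i a 0 j] True
    by (simp only: umbral_action_def if_True pCons_0_0 add_0_right)
qed (simp add: umbral_action_def generator_def)

text \<open>One s-derivative is computed twice: termwise through the parameters, giving minus the
  generator, and through the umbral form. Uniqueness of derivatives equates the results, and the
  right side already has the shape of a Lie derivative.\<close>

lemma killing_comp_generator:
  assumes pq: "p + q = n"
  shows "killing_comp (generator n w a b c) p q z =
    (w * z $ 2 + a) * (real q * killing_comp c p (q - 1) z)
    + (w * z $ 1 + b) * (real p * killing_comp c (p - 1) q z)
    - w * (real p * killing_comp c (p - 1) (q + 1) z + real q * killing_comp c (p + 1) (q - 1) z)"
proof -
  let ?A = "\<lambda>s. cst (cosh (s * w)) * \<alpha> + cst (sinh (s * w)) * \<beta> - cst (s * b)"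
  let ?B = "\<lambda>s. cst (sinh (s * w)) * \<alpha> + cst (cosh (s * w)) * \<beta> - cst (s * a)"
  define X T where "X = \<alpha> + cst (z $ 2)" and "T = \<beta> + cst (z $ 1)"
  have "((\<lambda>s. killing_comp (umbral_action n c (?A s) (?B s)) p q z) has_real_derivative
      killing_comp (\<lambda>i j. - generator n w a b c i j) p q z) (at 0)"
    unfolding killing_comp_def
    by (intro DERIV_sum DERIV_cmult DERIV_cmult_right umbral_action_derivative)
  moreover have "((\<lambda>s. killing_comp (umbral_action n c (?A s) (?B s)) p q z) has_real_derivative
      umbral n c (cst (real p) * X ^ (p - 1) * (cst w * \<beta> - cst b) * T ^ q +
      X ^ p * (cst (real q) * T ^ (q - 1) * (cst w * \<alpha> - cst a)))) (at 0)"
    unfolding killing_comp_umbral_action[OF pq] X_def T_def by (rule umbral_power_derivative)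
  ultimately have "killing_comp (\<lambda>i j. - generator n w a b c i j) p q z =
      umbral n c (cst (real p) * X ^ (p - 1) * (cst w * \<beta> - cst b) * T ^ q +
      X ^ p * (cst (real q) * T ^ (q - 1) * (cst w * \<alpha> - cst a)))"
    by (rule DERIV_unique)
  \<comment> \<open>In terms of X and T the components of \<open>killing_field\<close> at z appear
    as scalars, and the functional turns the remaining powers into components.\<close>
  also have "cst w * \<beta> - cst b = cst w * T - cst (w * z $ 1 + b)"
    by (simp add: T_def algebra_simps)
  also have "cst w * \<alpha> - cst a = cst w * X - cst (w * z $ 2 + a)"
    by (simp add: X_def algebra_simps)
  also have "cst (real p) * X ^ (p - 1) * (cst w * T - cst (w * z $ 1 + b)) * T ^ q +
      X ^ p * (cst (real q) * T ^ (q - 1) * (cst w * X - cst (w * z $ 2 + a))) =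
      cst (real p) * (cst w * (X ^ (p - 1) * T ^ (q + 1)) - cst (w * z $ 1 + b) * (X ^ (p - 1) * T ^ q)) +
      cst (real q) * (cst w * (X ^ (p + 1) * T ^ (q - 1)) - cst (w * z $ 2 + a) * (X ^ p * T ^ (q - 1)))"
    unfolding power_add power_one_right by (simp only: algebra_simps)
  also have "umbral n c \<dots> =
      real p * (w * killing_comp c (p - 1) (q + 1) z - (w * z $ 1 + b) * killing_comp c (p - 1) q z) +
      real q * (w * killing_comp c (p + 1) (q - 1) z - (w * z $ 2 + a) * killing_comp c p (q - 1) z)"
    unfolding umbral_add umbral_diff umbral_cst
    unfolding X_def T_def killing_comp_umbral[OF c, symmetric] ..
  also have "killing_comp (\<lambda>i j. - generator n w a b c i j) p q z = - killing_comp (generator n w a b c) p q z"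
    by (simp add: killing_comp_def sum_negf)
  finally show ?thesis by (simp add: algebra_simps)
qed

text \<open>The Jacobian of the field is \<open>w\<close> off the diagonal and 0 on it, so in each
  slot the index flips, shifting the counts to (p - 1, q + 1) or (p + 1, q - 1). What results is
  \<open>killing_comp_generator\<close>.\<close>

lemma lie_derivative_killing_tensor:
  "lie_derivative (killing_field w a b) (killing_tensor n c) = killing_tensor n (generator n w a b c)"
proof (intro ext)
  fix z :: plane and I :: "2 list"
  show "lie_derivative (killing_field w a b) (killing_tensor n c) z I = killing_tensor n (generator n w a b c) z I"
  proof (cases "length I = n")
    case False
    then show ?thesis by (simp add: lie_derivative_def killing_tensor_eq_comp)
  next
    case I: True
    let ?p = "count_list I 1" and ?q = "count_list I 2"
    define G where "G h = w * (if h = (1 :: 2) then killing_comp c (?p - 1) (?q + 1) z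
      else killing_comp c (?p + 1) (?q - 1) z)" for h
    have Y1: "partial_d k (\<lambda>u. killing_field w a b u $ 1) z = (if k = 1 then 0 else w)" for k
      using partial_d_affine[of k 0 w a z] by (simp add: killing_field_def mult.commute)
    have Y2: "partial_d k (\<lambda>u. killing_field w a b u $ 2) z = (if k = 1 then w else 0)" for k
      using partial_d_affine[of k w 0 b z] by (simp add: killing_field_def mult.commute)
    have G: "(\<Sum>k\<in>UNIV. partial_d k (\<lambda>u. killing_field w a b u $ (I ! r)) z * killing_tensor n c z (I[r := k])) = G (I ! r)"
      if r: "r < length I" for r
    proof -
      have m: "mset (I[r := k]) = add_mset k (mset I - {#I ! r#})" for k
        using r by (rule mset_update)
      have cnt: "count_list (I[r := k]) l = (if k = l then 1 else 0) + (count_list I l - (if I ! r = l then 1 else 0))" for k l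
        using arg_cong[OF m[of k], of "\<lambda>M. count M l"] by (simp add: count_mset)
      consider "I ! r = 1" | "I ! r = 2" using exhaust_2 by blast
      then show ?thesis
        by cases (simp_all add: UNIV_2 Y1 Y2 G_def killing_tensor_eq_comp I cnt)
    qed
    have sum_G: "(\<Sum>r<length I. \<Sum>k\<in>UNIV. partial_d k (\<lambda>u. killing_field w a b u $ (I ! r)) z
        * killing_tensor n c z (I[r := k])) = (\<Sum>r<length I. G (I ! r))"
      by (intro sum.cong refl G) simp
    have K: "(\<lambda>u. killing_tensor n c u I) = killing_comp c ?p ?q"
      by (simp add: killing_tensor_eq_comp I)
    have "lie_derivative (killing_field w a b) (killing_tensor n c) z I =
        (w * z $ 2 + a) * (real ?q * killing_comp c ?p (?q - 1) z)
        + (w * z $ 1 + b) * (real ?p * killing_comp c (?p - 1) ?q z) - (\<Sum>r<length I. G (I ! r))"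
      unfolding lie_derivative_def K sum_G by (simp add: UNIV_2 partial_d_killing_comp killing_field_def)
    then show ?thesis
      using I count_list_1_2[of I] unfolding sum_nth_2
      by (simp add: killing_tensor_eq_comp killing_comp_generator G_def algebra_simps)
  qed
qed

lemma pi_lie_killing_field: "pi_lie n (killing_field w a b) c = generator n w a b c"
  unfolding pi_lie_def lie_derivative_killing_tensor
  by (rule killing_params_killing_tensor[OF generator_in_param_space])

lemma param_action_mink_isom:
  "param_action n (mink_isom \<phi> a b) c =
    umbral_action n c (cst (cosh \<phi>) * \<alpha> + cst (sinh \<phi>) * \<beta> - cst b)
      (cst (sinh \<phi>) * \<alpha> + cst (cosh \<phi>) * \<beta> - cst a)"
  unfolding param_action_def pushforward_killing_tensor[OF c]
  by (rule killing_params_killing_tensor[OF umbral_action_in_param_space])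

end

text \<open>Both \<open>pi_lie\<close> and the velocity of the action are known through
  \<open>generator\<close>, which enters the velocity with the minus sign of the convention.\<close>

lemma generates_action_killing_field:
  assumes "is_flow (killing_field w a b) (\<lambda>s. mink_isom (s * w) (s * a) (s * b))"
  shows "generates_action n (killing_field w a b) (pi_lie n (killing_field w a b))"
  unfolding generates_action_def
proof (intro exI[of _ "\<lambda>s. mink_isom (s * w) (s * a) (s * b)"] conjI ballI allI assms)
  show "mink_isom (s * w) (s * a) (s * b) \<in> isom_group" for s
    unfolding isom_group_def by blast
  show "((\<lambda>s. param_action n (mink_isom (s * w) (s * a) (s * b)) c i j) has_real_derivative
      - pi_lie n (killing_field w a b) c i j) (at 0)" if "c \<in> param_space n" for c i j
    unfolding param_action_mink_isom[OF that] pi_lie_killing_field[OF that]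
    by (rule umbral_action_derivative[OF that])
qed

section \<open>Flows of the three Killing vectors\<close>

lemma vf_T_X_H: "vf_T = killing_field 0 1 0" "vf_X = killing_field 0 0 1" "vf_H = killing_field 1 0 0"
  by (simp_all add: fun_eq_iff killing_field_def vf_T_def vf_X_def vf_H_def)

lemma has_vector_derivative_plane:
  assumes "((\<lambda>s. f s $ 1) has_real_derivative D $ 1) (at s)" "((\<lambda>s. f s $ 2) has_real_derivative D $ 2) (at s)"
  shows "(f has_vector_derivative (D :: plane)) (at s)"
  using assms
  unfolding has_vector_derivative_def has_field_derivative_def has_derivative_componentwise_within[where f = f]
  by (auto simp: Basis_vec_def inner_axis forall_2 mult.commute[of _ "D $ _"])

text \<open>With a boost and a translation both present these isometries form no flow: the field at
  the moved point picks up extra terms \<open>w * (s * b)\<close> and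
  \<open>w * (s * a)\<close>.\<close>

lemma is_flow_killing_field:
  assumes "w = 0 \<or> a = 0 \<and> b = 0"
  shows "is_flow (killing_field w a b) (\<lambda>s. mink_isom (s * w) (s * a) (s * b))"
  unfolding is_flow_def
proof (intro conjI allI)
  show "mink_isom (0 * w) (0 * a) (0 * b) z = z" for z
    by (simp add: mink_isom_def vec_eq_iff forall_2)
  show "((\<lambda>s. mink_isom (s * w) (s * a) (s * b) z) has_vector_derivative
      killing_field w a b (mink_isom (s * w) (s * a) (s * b) z)) (at s)" for s z
    using assms by (intro has_vector_derivative_plane)
      (auto simp: mink_isom_def killing_field_def algebra_simps intro!: derivative_eq_intros)
qed

section \<open>The generators in coordinates\<close>

lemma sum_coord_field:
  assumes "finite S"
  shows "(\<Sum>(i, j)\<in>S. g i j * coord_field i j k l) = (if (k, l) \<in> S then g k l else 0)"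
proof -
  have "(\<Sum>(i, j)\<in>S. g i j * coord_field i j k l) = (\<Sum>s\<in>S. if s = (k, l) then g k l else 0)"
    by (intro sum.cong) (auto simp: coord_field_def split: if_splits)
  then show ?thesis using assms by simp
qed

lemma finite_index_set: "finite {(i, j). P i j \<and> i + j \<le> (n :: nat)}"
  by (rule finite_subset[of _ "{..n} \<times> {..n}"]) auto

theorem lemma3p1:
  fixes n :: nat
  assumes "n \<ge> 1"
  shows "bij_betw (killing_tensor n) (param_space n) (killing_tensors n)
    \<and> (\<forall>f\<in>isom_group. \<forall>K\<in>killing_tensors n. pushforward f K \<in> killing_tensors n)
    \<and> killing_vector_basis vf_T vf_X vf_H
    \<and> (\<forall>Y\<in>{vf_T, vf_X, vf_H}.
        (\<forall>K\<in>killing_tensors n. lie_derivative Y K \<in> killing_tensors n)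
        \<and> generates_action n Y (pi_lie n Y))
    \<and> (\<forall>c\<in>param_space n.
        pi_lie n vf_T c = (\<lambda>k l. \<Sum>(i, j) | j \<ge> 1 \<and> i + j \<le> n.
          real j * c i (j - 1) * coord_field i j k l)
      \<and> pi_lie n vf_X c = (\<lambda>k l. \<Sum>(i, j) | i \<ge> 1 \<and> i + j \<le> n.
          real i * c (i - 1) j * coord_field i j k l)
      \<and> pi_lie n vf_H c = (\<lambda>k l. - (\<Sum>(i, j) | i + j \<le> n.
          (real i * c (i - 1) (j + 1) + real j * c (i + 1) (j - 1)) * coord_field i j k l)))"
proof (intro conjI ballI)
  show "bij_betw (killing_tensor n) (param_space n) (killing_tensors n)"
    by (rule bij_betw_killing_tensor)
  show "pushforward f K \<in> killing_tensors n" if f: "f \<in> isom_group" and K: "K \<in> killing_tensors n" for f K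
  proof -
    obtain c where "c \<in> param_space n" "K = killing_tensor n c"
      using killing_tensor_surj K by blast
    moreover obtain \<phi> a b where "f = mink_isom \<phi> a b"
      using f unfolding isom_group_def by blast
    ultimately show ?thesis
      by (simp only: pushforward_killing_tensor killing_tensor_in_killing_tensors)
  qed
  show "killing_vector_basis vf_T vf_X vf_H"
    by (rule killing_vector_basis_T_X_H)
  fix Y
  assume "Y \<in> {vf_T, vf_X, vf_H}"
  \<comment> \<open>The triples are (0, 1, 0), (0, 0, 1) and (1, 0, 0), each a pure translation or a
    pure boost.\<close>
  then obtain w a b where Y: "Y = killing_field w a b" "w = 0 \<or> a = 0 \<and> b = 0"
    unfolding vf_T_X_H by auto
  show "lie_derivative Y K \<in> killing_tensors n" if "K \<in> killing_tensors n" for K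
  proof -
    obtain c where "c \<in> param_space n" "K = killing_tensor n c"
      using killing_tensor_surj \<open>K \<in> killing_tensors n\<close> by blast
    then show ?thesis
      by (simp only: Y lie_derivative_killing_tensor killing_tensor_in_killing_tensors)
  qed
  show "generates_action n Y (pi_lie n Y)"
    unfolding Y(1) by (intro generates_action_killing_field is_flow_killing_field Y(2))
next
  fix c
  assume c: "c \<in> param_space n"
  show "pi_lie n vf_T c = (\<lambda>k l. \<Sum>(i, j) | j \<ge> 1 \<and> i + j \<le> n.
      real j * c i (j - 1) * coord_field i j k l)"
    \<comment> \<open>The range j \<ge> 1 omits only indices at which \<open>generator\<close>
      carries the factor j = 0.\<close>
    unfolding vf_T_X_H pi_lie_killing_field[OF c] sum_coord_field[OF finite_index_set]
    by (auto simp: generator_def fun_eq_iff)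
  show "pi_lie n vf_X c = (\<lambda>k l. \<Sum>(i, j) | i \<ge> 1 \<and> i + j \<le> n.
      real i * c (i - 1) j * coord_field i j k l)"
    unfolding vf_T_X_H pi_lie_killing_field[OF c] sum_coord_field[OF finite_index_set]
    by (auto simp: generator_def fun_eq_iff)
  show "pi_lie n vf_H c = (\<lambda>k l. - (\<Sum>(i, j) | i + j \<le> n.
      (real i * c (i - 1) (j + 1) + real j * c (i + 1) (j - 1)) * coord_field i j k l))"
    \<comment> \<open>With the trivial predicate the finiteness lemma fits the full triangle of
      indices.\<close>
    unfolding vf_T_X_H pi_lie_killing_field[OF c]
      sum_coord_field[OF finite_index_set[of "\<lambda>i j. True" n, unfolded simp_thms]]
    by (auto simp: generator_def fun_eq_iff)
qed

end
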